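(* Let $\Bbbk$ be a field. There exists an amenable (finitely generated) Lie algebra $\mathfrak L$ over $\Bbbk$ of exponential growth. It can even be chosen (locally finite-dimensional)-by-($1$-dimensional): there is an exact sequence of Lie algebras \[0\longrightarrow\mathfrak K\longrightarrow\mathfrak L\longrightarrow\mathfrak Q\longrightarrow0\] with $\mathfrak K$ locally finite-dimensional and $\dim\mathfrak Q=1$.
   Context: $U(\mathfrak L)$ denotes the universal enveloping algebra with its usual Hopf algebra structure. A Lie algebra $\mathfrak L$ is amenable if for every finite-dimensional subspace $F\le\mathfrak L$ and every $\epsilon>0$ there exists a finite-dimensional subcoalgebra $E\le U(\mathfrak L)$ with $\dim\frac{E+FE}{E}<\epsilon\dim E$, where $FE$ is the linear span of $\{fe:f\in F,e\in E\}$. A Lie algebra is locally finite-dimensional if every finite subset is contained in a finite-dimensional Lie subalgebra. For a Lie algebra $\mathfrak L$ generated by a finite-dimensional subspace $F$, put $B_1=F$ and $B_{n+1}=B_n+\langle[b,f]:b\in B_n,f\in F\rangle_{\Bbbk}$ for $n\ge1$. The growth of $\mathfrak L$ is the function $n\mapsto\dim B_n$; it is subexponential if $\limsup_{n\to\infty}(\dim B_n)^{1/n}\le1$, and exponential if $\limsup_{n\to\infty}(\dim B_n)^{1/n}>1$. *)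

theory Defs
  imports
    "Jordan_Normal_Form.VS_Connect"
    "HOL-Algebra.QuotRing"
    "HOL-Library.Poly_Mapping"
    "HOL-Library.Product_Plus"
    "HOL-Library.Extended_Real"
    "HOL-Library.Liminf_Limsup"
begin

section \<open>Lie algebras, local finiteness and growth\<close>

locale lie_algebra = vector_space scale
  for scale :: "'k::field \<Rightarrow> 'v::ab_group_add \<Rightarrow> 'v" (infixr \<open>*s\<close> 75) +
  fixes bracket :: "'v \<Rightarrow> 'v \<Rightarrow> 'v"
  assumes bracket_add_left: "bracket (x + y) z = bracket x z + bracket y z"
    and bracket_add_right: "bracket x (y + z) = bracket x y + bracket x z"
    and bracket_scale_left: "bracket (c *s x) y = c *s bracket x y"
    and bracket_scale_right: "bracket x (c *s y) = c *s bracket x y"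
    and bracket_self: "bracket x x = 0"
    and jacobi: "bracket x (bracket y z) + bracket y (bracket z x) + bracket z (bracket x y) = 0"
begin

definition finite_dim :: "'v set \<Rightarrow> bool" where
  "finite_dim S \<longleftrightarrow> (\<exists>B. finite B \<and> S \<subseteq> span B)"

definition lie_subalgebra :: "'v set \<Rightarrow> bool" where
  "lie_subalgebra S \<longleftrightarrow> subspace S \<and> (\<forall>x\<in>S. \<forall>y\<in>S. bracket x y \<in> S)"

definition lie_generates :: "'v set \<Rightarrow> bool" where
  "lie_generates X \<longleftrightarrow> \<Inter>{S. lie_subalgebra S \<and> X \<subseteq> S} = UNIV"

definition finitely_generated :: bool where
  "finitely_generated \<longleftrightarrow> (\<exists>X. finite X \<and> lie_generates X)"

definition locally_finite_dimensional :: bool where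
  "locally_finite_dimensional \<longleftrightarrow>
     (\<forall>X. finite X \<longrightarrow> (\<exists>S. lie_subalgebra S \<and> finite_dim S \<and> X \<subseteq> S))"

text \<open>The filtration starts at index 1; the value at index 0 is an immaterial filler.\<close>

fun growth_space :: "'v set \<Rightarrow> nat \<Rightarrow> 'v set" where
  "growth_space F 0 = {0}"
| "growth_space F (Suc 0) = F"
| "growth_space F (Suc (Suc n)) =
     {x + y | x y. x \<in> growth_space F (Suc n) \<and>
        y \<in> span {bracket b f | b f. b \<in> growth_space F (Suc n) \<and> f \<in> F}}"

text \<open>Whether the growth is exponential does not depend on the finite-dimensional generating
  subspace \<open>F\<close>.\<close>

definition exponential_growth :: bool where
  "exponential_growth \<longleftrightarrow>
     (\<exists>F. subspace F \<and> finite_dim F \<and> lie_generates F \<and>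
        1 < limsup (\<lambda>n. ereal (root n (real (dim (growth_space F n))))))"

end

definition lie_hom ::
  "('k::field \<Rightarrow> 'v::ab_group_add \<Rightarrow> 'v) \<Rightarrow> ('v \<Rightarrow> 'v \<Rightarrow> 'v) \<Rightarrow>
   ('k \<Rightarrow> 'w::ab_group_add \<Rightarrow> 'w) \<Rightarrow> ('w \<Rightarrow> 'w \<Rightarrow> 'w) \<Rightarrow> ('v \<Rightarrow> 'w) \<Rightarrow> bool" where
  "lie_hom s1 b1 s2 b2 f \<longleftrightarrow>
     Vector_Spaces.linear s1 s2 f \<and> (\<forall>x y. f (b1 x y) = b2 (f x) (f y))"


section \<open>Quotient spaces and quotient algebras\<close>

text \<open>\<^const>\<open>FactRing\<close> with scalar multiplication. If \<open>V\<close> is only a vector space and \<open>N\<close> a subspace,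
  the multiplicative part carries no meaning and the rest is the quotient space.\<close>

definition quotient_module :: "('k, 'u, 'm) module_scheme \<Rightarrow> 'u set \<Rightarrow> ('k, 'u set) module" where
  "quotient_module V N =
     \<lparr>carrier = a_rcosets\<^bsub>V\<^esub> N, mult = rcoset_mult V N, one = N +>\<^bsub>V\<^esub> \<one>\<^bsub>V\<^esub>,
      zero = N, add = set_add V,
      smult = (\<lambda>c C. \<Union>v\<in>C. N +>\<^bsub>V\<^esub> (c \<odot>\<^bsub>V\<^esub> v))\<rparr>"


section \<open>The free algebra and its coproduct\<close>

text \<open>With concatenation as the monoid operation, \<open>'v list \<Rightarrow>\<^sub>0 'k\<close> is the free associative algebra
  on the set \<open>'v\<close>. By the monoid structure on pairs, \<open>('v list \<times> 'v list) \<Rightarrow>\<^sub>0 'k\<close> is the tensor square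
  of this algebra.\<close>

instantiation list :: (type) monoid_add
begin
definition zero_list :: "'a list" where "zero_list = []"
definition plus_list :: "'a list \<Rightarrow> 'a list \<Rightarrow> 'a list" where "plus_list = (@)"
instance by standard (simp_all add: zero_list_def plus_list_def)
end

definition monoid_algebra :: "('k::field, 'm::monoid_add \<Rightarrow>\<^sub>0 'k) module" where
  "monoid_algebra =
     \<lparr>carrier = UNIV, mult = (*), one = 1, zero = 0, add = (+),
      smult = (\<lambda>c. Poly_Mapping.map ((*) c))\<rparr>"

definition gen :: "'v \<Rightarrow> 'v list \<Rightarrow>\<^sub>0 'k::field" where
  "gen x = Poly_Mapping.single [x] 1"

definition pure_tensor ::
  "('v list \<Rightarrow>\<^sub>0 'k::field) \<Rightarrow> ('v list \<Rightarrow>\<^sub>0 'k) \<Rightarrow> ('v list \<times> 'v list) \<Rightarrow>\<^sub>0 'k" where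
  "pure_tensor p q =
     (\<Sum>v\<in>Poly_Mapping.keys p. \<Sum>w\<in>Poly_Mapping.keys q.
        Poly_Mapping.single (v, w) (Poly_Mapping.lookup p v * Poly_Mapping.lookup q w))"

text \<open>The algebra homomorphism that makes every generator primitive.\<close>

definition free_comult ::
  "('v list \<Rightarrow>\<^sub>0 'k::field) \<Rightarrow> ('v list \<times> 'v list) \<Rightarrow>\<^sub>0 'k" where
  "free_comult p =
     (\<Sum>w\<in>Poly_Mapping.keys p.
        Poly_Mapping.map ((*) (Poly_Mapping.lookup p w))
          (prod_list (map (\<lambda>x. pure_tensor (gen x) 1 + pure_tensor 1 (gen x)) w)))"


section \<open>The universal enveloping algebra and amenability\<close>

context lie_algebra
begin

definition env_relations :: "('v list \<Rightarrow>\<^sub>0 'k) set" where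
  "env_relations =
     {gen (x + y) - gen x - gen y | x y. True} \<union>
     {gen (c *s x) - Poly_Mapping.map ((*) c) (gen x) | c x. True} \<union>
     {gen x * gen y - gen y * gen x - gen (bracket x y) | x y. True}"

text \<open>Dividing the free algebra on the set \<open>'v\<close> by the first two families of relations gives the
  tensor algebra of the vector space \<open>'v\<close>.\<close>

definition env_ideal :: "('v list \<Rightarrow>\<^sub>0 'k) set" where
  "env_ideal = genideal monoid_algebra env_relations"

definition env_algebra :: "('k, ('v list \<Rightarrow>\<^sub>0 'k) set) module" where
  "env_algebra = quotient_module monoid_algebra env_ideal"

definition env_inj :: "'v \<Rightarrow> ('v list \<Rightarrow>\<^sub>0 'k) set" where
  "env_inj x = env_ideal +>\<^bsub>monoid_algebra\<^esub> gen x"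

text \<open>For the free algebra \<open>T\<close> and its ideal \<open>I\<close>, the tensor square of \<open>T/I\<close> is the quotient of
  \<open>T \<otimes> T\<close> by \<open>I \<otimes> T + T \<otimes> I\<close>.\<close>

definition env_tensor_ideal :: "(('v list \<times> 'v list) \<Rightarrow>\<^sub>0 'k) set" where
  "env_tensor_ideal =
     LinearCombinations.module.span class_ring monoid_algebra
       {pure_tensor p q | p q. p \<in> env_ideal \<or> q \<in> env_ideal}"

definition env_tensor_square :: "('k, (('v list \<times> 'v list) \<Rightarrow>\<^sub>0 'k) set) module" where
  "env_tensor_square = quotient_module monoid_algebra env_tensor_ideal"

text \<open>The next two operations are defined through all representatives of their arguments; the
  result is a single coset, independent of the representatives.\<close>

definition env_tensor ::
  "('v list \<Rightarrow>\<^sub>0 'k) set \<Rightarrow> ('v list \<Rightarrow>\<^sub>0 'k) set \<Rightarrow> (('v list \<times> 'v list) \<Rightarrow>\<^sub>0 'k) set" where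
  "env_tensor C D =
     (\<Union>p\<in>C. \<Union>q\<in>D. env_tensor_ideal +>\<^bsub>monoid_algebra\<^esub> pure_tensor p q)"

definition env_comult :: "('v list \<Rightarrow>\<^sub>0 'k) set \<Rightarrow> (('v list \<times> 'v list) \<Rightarrow>\<^sub>0 'k) set" where
  "env_comult C = (\<Union>p\<in>C. env_tensor_ideal +>\<^bsub>monoid_algebra\<^esub> free_comult p)"

definition subcoalgebra :: "('v list \<Rightarrow>\<^sub>0 'k) set set \<Rightarrow> bool" where
  "subcoalgebra E \<longleftrightarrow>
     VectorSpace.subspace class_ring E env_algebra \<and>
     (\<forall>C\<in>E. env_comult C \<in>
        LinearCombinations.module.span class_ring env_tensor_square
          {env_tensor A B | A B. A \<in> E \<and> B \<in> E})"

definition env_act ::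
  "'v set \<Rightarrow> ('v list \<Rightarrow>\<^sub>0 'k) set set \<Rightarrow> ('v list \<Rightarrow>\<^sub>0 'k) set set" where
  "env_act F E =
     LinearCombinations.module.span class_ring env_algebra
       {env_inj f \<otimes>\<^bsub>env_algebra\<^esub> e | f e. f \<in> F \<and> e \<in> E}"

definition amenable :: bool where
  "amenable \<longleftrightarrow>
     (\<forall>F. \<forall>\<epsilon>::real. subspace F \<longrightarrow> finite_dim F \<longrightarrow> 0 < \<epsilon> \<longrightarrow>
        (\<exists>E. subcoalgebra E \<and>
           vectorspace.fin_dim class_ring (env_algebra\<lparr>carrier := E\<rparr>) \<and>
           real (vectorspace.dim class_ring
             (quotient_module
               (env_algebra\<lparr>carrier := E <+>\<^bsub>env_algebra\<^esub> env_act F E\<rparr>) E))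
           < \<epsilon> * real (vectorspace.dim class_ring (env_algebra\<lparr>carrier := E\<rparr>))))"

end

end

theory Submission
  imports Defs "HOL-Library.Sublist" "HOL-Library.Countable_Set"
begin

text \<open>
  Take the monomial algebra on letters \<open>t, x, y, z\<close> whose nonzero words are the factors \<open>w\<close> of the block
  words, and the words \<open>z w\<close>; here the blocks of level \<open>0\<close> are \<open>x\<close> and \<open>y\<close>, and those of level
  \<open>m + 1\<close> are \<open>u t\<^sup>m v\<close> with \<open>u, v\<close> of level \<open>m\<close>. Let \<open>L\<close> be the Lie algebra generated by the letters.
  As \<open>z\<close> can only be the first letter, \<open>[[z, a\<^sub>1], \<dots>, a\<^sub>n] = z a\<^sub>1 \<dots> a\<^sub>n\<close>, and there are
  \<open>2 ^ 2 ^ m\<close> blocks of level \<open>m\<close>, all of length less than \<open>2 ^ (m + 1)\<close>: the growth is exponential. Let \<open>K\<close> be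
  the kernel of the coefficient of \<open>t\<close>. Its elements are combinations of words with a letter other than
  \<open>t\<close>; products of such words of bounded length have bounded \<open>t\<close>-runs, and a nonzero word with bounded
  \<open>t\<close>-runs has boundedly many other letters. So \<open>K\<close> is locally finite-dimensional.

  For amenability, let \<open>B\<close> span a finite-dimensional subalgebra of \<open>K\<close> that contains enough iterated
  brackets with \<open>t\<close> of the \<open>K\<close>-part of \<open>F\<close>. The span \<open>E\<close> of the words \<open>t\<^sup>i b\<^sub>1 \<dots> b\<^sub>m\<close> with
  \<open>i \<le> N\<close>, \<open>m \<le> M\<close> and \<open>b\<^sub>j \<in> B\<close> is a subcoalgebra, and \<open>F E\<close> lies in the span for \<open>(N + 1, M + 1)\<close>.
  Letters of \<open>B\<close> commute up to shorter words, so the dimension for \<open>N = 0\<close> is at most polynomial in \<open>M\<close>,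
  and some pair \<open>(N, M)\<close> gives an almost invariant \<open>E\<close>. Only upper bounds on dimensions are needed, hence
  not the linear independence in the Poincare-Birkhoff-Witt theorem.
\<close>

section \<open>Modules parametrised by vector spaces\<close>

text \<open>Carrier-based modules are described by a linear map \<open>f\<close> from a subspace
  \<open>S\<close> of a type-based vector space onto them. Spans and dimensions in the enveloping
  algebra, its tensor square, their subspaces and quotients are thereby computed with
  \<open>span\<close> and \<open>dim\<close> on a type. That \<open>V\<close> is a vector space is
  derived from these data.\<close>

locale onto_module = vector_space scale
  for scale :: "'k::field \<Rightarrow> 'a::ab_group_add \<Rightarrow> 'a" +
  fixes S :: "'a set" and f :: "'a \<Rightarrow> 'b" and V :: "('k, 'b, 'm) module_scheme"
  assumes subspace_dom: "subspace S"
    and image_dom: "f ` S = carrier V"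
    and map_zero: "f 0 = \<zero>\<^bsub>V\<^esub>"
    and map_add: "\<And>x y. x \<in> S \<Longrightarrow> y \<in> S \<Longrightarrow> f (x + y) = f x \<oplus>\<^bsub>V\<^esub> f y"
    and map_scale: "\<And>c x. x \<in> S \<Longrightarrow> f (scale c x) = c \<odot>\<^bsub>V\<^esub> f x"
begin

lemmas dom_closed = subspace_0[OF subspace_dom] subspace_add[OF subspace_dom]
  subspace_scale[OF subspace_dom] subspace_neg[OF subspace_dom] subspace_diff[OF subspace_dom]

lemma is_vectorspace: "vectorspace class_ring V"
proof -
  have "Module.module class_ring V"
  proof (rule module_criteria, goal_cases)
    case 4
    show ?case
    proof
      fix v assume "v \<in> carrier V"
      then obtain x where x: "x \<in> S" "v = f x"
        using image_dom by blast
      show "\<exists>neg_v\<in>carrier V. v \<oplus>\<^bsub>V\<^esub> neg_v = \<zero>\<^bsub>V\<^esub>"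
        using x map_add[of x "- x"] map_zero image_dom dom_closed(4)[of x] by force
    qed
  qed (use class_cring.is_cring in \<open>auto simp: image_dom[symmetric] map_zero[symmetric] map_add[symmetric]
      map_scale[symmetric] dom_closed algebra_simps\<close>)
  then show ?thesis
    by (simp add: vectorspace_def class_field)
qed

sublocale V: vectorspace class_ring V
  by (rule is_vectorspace)

lemma submodule_image:
  assumes "subspace U" "U \<subseteq> S"
  shows "submodule class_ring (f ` U) V"
proof
  show "f ` U \<subseteq> carrier V"
    using assms image_dom by blast
  show "\<zero>\<^bsub>V\<^esub> \<in> f ` U"
    using subspace_0[OF assms(1)] map_zero by (metis imageI)
  show "v \<oplus>\<^bsub>V\<^esub> w \<in> f ` U" if vw: "v \<in> f ` U" "w \<in> f ` U" for v w
  proof -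
    obtain x y where "x \<in> U" "y \<in> U" "v = f x" "w = f y"
      using vw by blast
    then show ?thesis
      using assms map_add[of x y] subspace_add[OF assms(1), of x y] by (metis imageI subsetD)
  qed
  show "c \<odot>\<^bsub>V\<^esub> v \<in> f ` U" if v: "v \<in> f ` U" for c v
  proof -
    obtain x where "x \<in> U" "v = f x"
      using v by blast
    then show ?thesis
      using assms map_scale[of x c] subspace_scale[OF assms(1), of x c] by (metis imageI subsetD)
  qed
qed

lemma subspace_image:
  assumes "subspace U" "U \<subseteq> S"
  shows "VectorSpace.subspace class_ring (f ` U) V"
  by (intro VectorSpace.subspace.intro is_vectorspace submodule_image assms)

lemma span_image:
  assumes "B \<subseteq> S"
  shows "f ` span B = LinearCombinations.module.span class_ring V (f ` B)"
proof
  have "span B \<subseteq> S"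
    using assms span_minimal subspace_dom by blast
  have BV: "f ` B \<subseteq> carrier V"
    using assms image_dom by blast
  have sub: "submodule class_ring (V.module.span (f ` B)) V"
    by (rule V.module.span_is_submodule[OF BV])
  have "subspace {x \<in> S. f x \<in> V.module.span (f ` B)}"
    by (rule subspaceI)
      (use submodule.m_closed[OF sub] submodule.smult_closed[OF sub] submodule.zero_closed[OF sub] in
        \<open>auto simp: dom_closed map_zero map_add map_scale\<close>)
  moreover have "B \<subseteq> {x \<in> S. f x \<in> V.module.span (f ` B)}"
    using assms V.module.in_own_span[OF BV] by blast
  ultimately have "span B \<subseteq> {x \<in> S. f x \<in> V.module.span (f ` B)}"
    by (rule span_minimal[rotated])
  then show "f ` span B \<subseteq> V.module.span (f ` B)"
    by blast
  show "V.module.span (f ` B) \<subseteq> f ` span B"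
    by (rule V.module.span_is_subset)
      (use submodule_image[OF subspace_span \<open>span B \<subseteq> S\<close>] span_superset in auto)
qed

text \<open>The image of \<open>B\<close> generates \<open>V\<close> even if \<open>B\<close> spans
  \<open>S\<close> only modulo the kernel of \<open>f\<close>; quotients use this freedom.\<close>

lemma fin_dim_dim_le:
  assumes "finite B" "B \<subseteq> S" "f ` S \<subseteq> f ` span B"
  shows "V.fin_dim" "V.dim \<le> card B"
proof -
  have "f ` S = f ` span B"
    using assms span_minimal[OF assms(2) subspace_dom] by blast
  then have gen: "V.gen_set (f ` B)"
    using span_image[OF assms(2)] image_dom by simp
  have BV: "f ` B \<subseteq> carrier V"
    using assms(2) image_dom by blast
  show "V.fin_dim"
    using BV gen assms(1) unfolding V.fin_dim_def by (intro exI[of _ "f ` B"]) simp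
  show "V.dim \<le> card B"
    using V.gen_ge_dim[OF _ BV gen] assms(1) card_image_le[of B f] by (meson finite_imageI le_trans)
qed

text \<open>A basis of \<open>V\<close> has preimages \<open>A1\<close> in \<open>S\<close>. By
  injectivity they span \<open>S\<close>, which gives the lower bound; the upper bound is
  \<open>fin_dim_dim_le\<close>.\<close>

lemma dim_eq:
  assumes inj: "inj_on f S" and fin: "finite G" "S \<subseteq> span G"
  shows "V.fin_dim" "V.dim = dim S"
proof -
  obtain B where B: "B \<subseteq> S" "independent B" "S \<subseteq> span B" "card B = dim S"
    by (rule basis_exists)
  have "finite B"
    using independent_span_bound[OF fin(1) B(2)] B fin by blast
  have le: "V.fin_dim" "V.dim \<le> card B"
    using fin_dim_dim_le[OF \<open>finite B\<close>] B by blast+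
  show "V.fin_dim"
    by (rule le(1))
  obtain A where A: "finite A" "V.basis A"
    using V.finite_basis_exists[OF le(1)] by blast
  then have A': "A \<subseteq> carrier V" "V.gen_set A" "V.dim = card A"
    using V.dim_basis unfolding V.basis_def by auto
  then obtain A1 where A1: "A1 \<subseteq> S" "A = f ` A1" "inj_on f A1"
    using image_dom subset_image_inj by metis
  then have "f ` S = f ` span A1"
    using span_image A'(2) image_dom by auto
  moreover have "span A1 \<subseteq> S"
    using A1 span_minimal subspace_dom by blast
  ultimately have "S = span A1"
    using inj by (metis inj_on_image_eq_iff order_refl)
  then have "card B \<le> card A1"
    using independent_span_bound[of A1 B] A1 A B finite_imageD by blast
  then show "V.dim = dim S"
    using le A' A1 B by (simp add: card_image)
qed

lemma onto_module_subspace: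
  assumes "subspace U" "U \<subseteq> S"
  shows "onto_module scale U f (V\<lparr>carrier := f ` U\<rparr>)"
  using assms by unfold_locales (auto simp: map_zero map_add map_scale subset_iff)

lemma coset_image:
  assumes "N \<subseteq> S" "x \<in> S"
  shows "f ` N +>\<^bsub>V\<^esub> f x = f ` ((\<lambda>n. n + x) ` N)"
  using assms by (force simp: a_r_coset_def' map_add)

text \<open>The quotient is parametrised by the same \<open>S\<close>, so the dimension bounds apply
  to it. Every coset is the image of a translate of \<open>N\<close>, and sums and multiples of
  translates are computed in \<open>S\<close>.\<close>

lemma onto_quotient_module:
  assumes N: "subspace N" "N \<subseteq> S"
  shows "onto_module scale S (\<lambda>x. f ` N +>\<^bsub>V\<^esub> f x) (quotient_module V (f ` N))"
proof
  note N_closed = subspace_0[OF N(1)] subspace_add[OF N(1)] subspace_scale[OF N(1)]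
    subspace_diff[OF N(1)]
  show "subspace S"
    by (rule subspace_dom)
  show "(\<lambda>x. f ` N +>\<^bsub>V\<^esub> f x) ` S = carrier (quotient_module V (f ` N))"
    by (auto simp: quotient_module_def A_RCOSETS_def' image_dom[symmetric])
  show "f ` N +>\<^bsub>V\<^esub> f 0 = \<zero>\<^bsub>quotient_module V (f ` N)\<^esub>"
    using coset_image[OF N(2) dom_closed(1)] by (simp add: quotient_module_def)
  fix x assume x: "x \<in> S"
  show "f ` N +>\<^bsub>V\<^esub> f (x + y) =
      (f ` N +>\<^bsub>V\<^esub> f x) \<oplus>\<^bsub>quotient_module V (f ` N)\<^esub> (f ` N +>\<^bsub>V\<^esub> f y)" if y: "y \<in> S" for y
  proof -
    have "(f ` N +>\<^bsub>V\<^esub> f x) <+>\<^bsub>V\<^esub> (f ` N +>\<^bsub>V\<^esub> f y) =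
        (\<Union>n\<in>N. \<Union>m\<in>N. {f (n + x) \<oplus>\<^bsub>V\<^esub> f (m + y)})"
      by (auto simp: coset_image[OF N(2)] x y set_add_defs)
    also have "\<dots> = (\<Union>n\<in>N. \<Union>m\<in>N. {f ((n + m) + (x + y))})"
      using N x y by (intro SUP_cong refl) (auto simp: map_add[symmetric] dom_closed subset_iff algebra_simps)
    also have "\<dots> = f ` ((\<lambda>n. n + (x + y)) ` N)"
    proof
      show "f ` (\<lambda>n. n + (x + y)) ` N \<subseteq> (\<Union>n\<in>N. \<Union>m\<in>N. {f ((n + m) + (x + y))})"
        using N_closed(1) by force
    qed (use N_closed in auto)
    finally show ?thesis
      using coset_image[OF N(2) dom_closed(2)[OF x y]] by (simp add: quotient_module_def)
  qed
  show "f ` N +>\<^bsub>V\<^esub> f (scale c x) =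
      c \<odot>\<^bsub>quotient_module V (f ` N)\<^esub> (f ` N +>\<^bsub>V\<^esub> f x)" for c
  proof -
    have "f ` N +>\<^bsub>V\<^esub> (c \<odot>\<^bsub>V\<^esub> f (n + x)) = f ` ((\<lambda>n. n + scale c x) ` N)" if n: "n \<in> N" for n
    proof -
      have "f ` N +>\<^bsub>V\<^esub> (c \<odot>\<^bsub>V\<^esub> f (n + x)) = f ` N +>\<^bsub>V\<^esub> f (scale c (n + x))"
        using n N x by (subst map_scale) (auto simp: dom_closed)
      also have "\<dots> = f ` ((\<lambda>m. m + scale c (n + x)) ` N)"
        using n N x by (intro coset_image) (auto simp: dom_closed)
      also have "(\<lambda>m. m + scale c (n + x)) ` N = (\<lambda>m. m + scale c x) ` N"
      proof safe
        fix m assume "m \<in> N"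
        then show "m + scale c (n + x) \<in> (\<lambda>m. m + scale c x) ` N"
          using n N_closed by (intro image_eqI[of _ _ "m + scale c n"]) (auto simp: algebra_simps)
        show "m + scale c x \<in> (\<lambda>m. m + scale c (n + x)) ` N"
          using n N_closed \<open>m \<in> N\<close> by (intro image_eqI[of _ _ "m - scale c n"]) (auto simp: algebra_simps)
      qed
      finally show ?thesis .
    qed
    then have "c \<odot>\<^bsub>quotient_module V (f ` N)\<^esub> (f ` N +>\<^bsub>V\<^esub> f x) = f ` ((\<lambda>n. n + scale c x) ` N)"
      using N_closed(1) by (auto simp: quotient_module_def coset_image[OF N(2) x])
    then show ?thesis
      using coset_image[OF N(2) dom_closed(3)[OF x, of c]] by simp
  qed
qed

text \<open>A basis \<open>B\<close> of \<open>N\<close> is extended to a basis \<open>C\<close> of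
  \<open>S\<close>. The cosets of \<open>C - B\<close> generate the quotient, because the component
  in \<open>span B\<close> is absorbed by \<open>N\<close>.\<close>

lemma dim_quotient_le:
  assumes fin: "finite G" "S \<subseteq> span G" and N: "subspace N" "N \<subseteq> S"
  shows "vectorspace.dim class_ring (quotient_module V (f ` N)) \<le> dim S - dim N"
proof -
  interpret Q: onto_module scale S "\<lambda>x. f ` N +>\<^bsub>V\<^esub> f x" "quotient_module V (f ` N)"
    by (rule onto_quotient_module[OF N])
  obtain B where B: "B \<subseteq> N" "independent B" "N \<subseteq> span B" "card B = dim N"
    by (rule basis_exists)
  obtain C where C: "B \<subseteq> C" "C \<subseteq> S" "independent C" "S \<subseteq> span C"
    by (rule maximal_independent_subset_extend[of B S]) (use B N in auto)
  then have cC: "card C = dim S"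
    using basis_card_eq_dim by blast
  have finC: "finite C"
    using independent_span_bound[OF fin(1) C(3)] C fin by blast
  have "f ` N +>\<^bsub>V\<^esub> f x \<in> (\<lambda>x. f ` N +>\<^bsub>V\<^esub> f x) ` span (C - B)" if x: "x \<in> S" for x
  proof -
    have "x \<in> span (B \<union> (C - B))"
      using x C by (simp add: Un_absorb1 subset_iff)
    then obtain u v where uv: "u \<in> span B" "v \<in> span (C - B)" "x = u + v"
      unfolding span_Un by blast
    have "u \<in> N"
      using uv(1) B N span_minimal by blast
    have "v \<in> S"
      using uv(2) C span_minimal[OF _ subspace_dom, of "C - B"] by blast
    have "(\<lambda>n. n + x) ` N = (\<lambda>n. n + v) ` N"
    proof safe
      fix n assume n: "n \<in> N"
      show "n + x \<in> (\<lambda>n. n + v) ` N"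
        using uv n \<open>u \<in> N\<close> subspace_add[OF N(1)] by (intro image_eqI[of _ _ "n + u"]) (auto simp: algebra_simps)
      show "n + v \<in> (\<lambda>n. n + x) ` N"
        using uv n \<open>u \<in> N\<close> subspace_diff[OF N(1)] by (intro image_eqI[of _ _ "n - u"]) (auto simp: algebra_simps)
    qed
    then have "f ` N +>\<^bsub>V\<^esub> f x = f ` N +>\<^bsub>V\<^esub> f v"
      using coset_image[OF N(2)] x \<open>v \<in> S\<close> by simp
    then show ?thesis
      using uv(2) by blast
  qed
  then have "Q.V.dim \<le> card (C - B)"
    using finC C by (intro Q.fin_dim_dim_le) auto
  also have "\<dots> = dim S - dim N"
    using B C cC finC by (simp add: card_Diff_subset finite_subset)
  finally show ?thesis .
qed

end

section \<open>The free algebra and its coproduct\<close>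

abbreviation pm_scale :: "'k::field \<Rightarrow> ('a \<Rightarrow>\<^sub>0 'k) \<Rightarrow> ('a \<Rightarrow>\<^sub>0 'k)" where
  "pm_scale c p \<equiv> Poly_Mapping.map ((*) c) p"

lemma lookup_pm_scale [simp]: "Poly_Mapping.lookup (pm_scale c p) k = c * Poly_Mapping.lookup p k"
  by (simp add: Poly_Mapping.map.rep_eq when_def)

interpretation pm: vector_space pm_scale
  by standard (auto intro!: poly_mapping_eqI simp: lookup_add algebra_simps)

lemma pm_scale_mult_left: "pm_scale c p * q = pm_scale c (p * q)"
  for p :: "'m::monoid_add \<Rightarrow>\<^sub>0 'k::field"
  by (simp add: mult_map_scale_conv_mult mult.assoc)

abbreviation pm_unit :: "'a \<Rightarrow> 'a \<Rightarrow>\<^sub>0 'k::field" where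
  "pm_unit k \<equiv> Poly_Mapping.single k 1"

lemma sum_keys_pm_unit: "(\<Sum>k\<in>Poly_Mapping.keys p. pm_scale (Poly_Mapping.lookup p k) (pm_unit k)) = p"
  by (rule poly_mapping_eqI)
    (auto simp: lookup_sum lookup_single when_def in_keys_iff sum.delta if_distrib cong: if_cong)

lemma span_pm_unit: "pm.span (range pm_unit) = UNIV"
proof -
  have "p \<in> pm.span (range pm_unit)" for p :: "'a \<Rightarrow>\<^sub>0 'k::field"
    by (subst sum_keys_pm_unit[symmetric]) (intro pm.span_sum pm.span_scale pm.span_base rangeI)
  then show ?thesis
    by blast
qed

lemma in_span_pm_unit: "Poly_Mapping.keys p \<subseteq> A \<Longrightarrow> p \<in> pm.span (pm_unit ` A)"
  by (subst sum_keys_pm_unit[symmetric]) (intro pm.span_sum pm.span_scale pm.span_base, blast)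

context vector_space
begin

lemma linear_sum_keys:
  "Vector_Spaces.linear pm_scale scale
    (\<lambda>p. \<Sum>k\<in>Poly_Mapping.keys p. scale (Poly_Mapping.lookup p k) (g k))"
proof -
  have eq: "(\<Sum>k\<in>Poly_Mapping.keys p. scale (Poly_Mapping.lookup p k) (g k)) =
      (\<Sum>k\<in>A. scale (Poly_Mapping.lookup p k) (g k))"
    if "finite A" "Poly_Mapping.keys p \<subseteq> A" for A and p :: "'c \<Rightarrow>\<^sub>0 'a"
    using that by (intro sum.mono_neutral_left) (auto simp: in_keys_iff)
  show ?thesis
  proof (rule Vector_Spaces.linear_iff[THEN iffD2], intro conjI allI)
    show "vector_space (pm_scale :: 'a \<Rightarrow> ('c \<Rightarrow>\<^sub>0 'a) \<Rightarrow> _)" "vector_space scale"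
      by unfold_locales
    fix p q :: "'c \<Rightarrow>\<^sub>0 'a" and c :: 'a
    let ?A = "Poly_Mapping.keys p \<union> Poly_Mapping.keys q"
    show "(\<Sum>k\<in>Poly_Mapping.keys (p + q). scale (Poly_Mapping.lookup (p + q) k) (g k)) =
        (\<Sum>k\<in>Poly_Mapping.keys p. scale (Poly_Mapping.lookup p k) (g k)) +
        (\<Sum>k\<in>Poly_Mapping.keys q. scale (Poly_Mapping.lookup q k) (g k))"
      using eq[of ?A "p + q"] eq[of ?A p] eq[of ?A q] Poly_Mapping.keys_add[of p q]
      by (simp add: lookup_add scale_left_distrib sum.distrib)
    show "(\<Sum>k\<in>Poly_Mapping.keys (pm_scale c p). scale (Poly_Mapping.lookup (pm_scale c p) k) (g k)) =
        scale c (\<Sum>k\<in>Poly_Mapping.keys p. scale (Poly_Mapping.lookup p k) (g k))"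
      using eq[of "Poly_Mapping.keys p" "pm_scale c p"]
      by (simp add: scale_sum_right subset_iff in_keys_iff)
  qed
qed

lemma sum_keys_linear:
  assumes "Vector_Spaces.linear pm_scale scale g"
  shows "g p = (\<Sum>k\<in>Poly_Mapping.keys p. scale (Poly_Mapping.lookup p k) (g (pm_unit k)))"
proof -
  interpret g: Vector_Spaces.linear pm_scale scale g
    by (rule assms)
  show ?thesis
    by (subst sum_keys_pm_unit[of p, symmetric]) (simp only: g.sum g.scale)
qed

lemma linear_eq_on_pm_unit:
  assumes "Vector_Spaces.linear pm_scale scale g" "Vector_Spaces.linear pm_scale scale h"
    and "\<And>k. g (pm_unit k) = h (pm_unit k)"
  shows "g p = h p"
  using sum_keys_linear[OF assms(1), of p] sum_keys_linear[OF assms(2), of p] assms(3) by simp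

end

lemma pm_linear_iff:
  "Vector_Spaces.linear pm_scale pm_scale g \<longleftrightarrow>
    (\<forall>p q. g (p + q) = g p + g q) \<and> (\<forall>c p. g (pm_scale c p) = pm_scale c (g p))"
  by (auto simp: Vector_Spaces.linear_iff pm.vector_space_axioms)

lemma pm_scale_mult_right: "p * pm_scale c q = pm_scale c (p * q)"
  for p :: "'m::monoid_add \<Rightarrow>\<^sub>0 'k::field"
proof -
  have "p * Poly_Mapping.single 0 c = Poly_Mapping.single 0 c * p"
    by (rule pm.linear_eq_on_pm_unit[where g = "\<lambda>p. p * Poly_Mapping.single 0 c"])
      (simp_all add: pm_linear_iff distrib_left distrib_right pm_scale_mult_left mult_single
        pm.scale_left_commute pm.scale_right_distrib flip: mult_map_scale_conv_mult del: map_single)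
  then show ?thesis
    by (metis mult_map_scale_conv_mult mult.assoc)
qed

lemma ring_monoid_algebra: "ring (monoid_algebra :: ('k::field, 'm::monoid_add \<Rightarrow>\<^sub>0 'k) module)"
  by unfold_locales (auto simp: monoid_algebra_def algebra_simps Units_def intro: exI[of _ "- x" for x])

lemma onto_monoid_algebra: "onto_module pm_scale UNIV id monoid_algebra"
  by (standard; simp add: monoid_algebra_def)

lemma mem_coset_monoid_algebra:
  "p \<in> I +>\<^bsub>monoid_algebra\<^esub> q \<longleftrightarrow> p - q \<in> I"
  by (force simp: a_r_coset_def' monoid_algebra_def)

lemma onto_quotient_monoid_algebra:
  assumes "pm.subspace I"
  shows "onto_module pm_scale UNIV (\<lambda>p. I +>\<^bsub>monoid_algebra\<^esub> p) (quotient_module monoid_algebra I)"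
  using onto_module.onto_quotient_module[OF onto_monoid_algebra assms] by simp

lemma coset_monoid_algebra_eqI:
  assumes "pm.subspace I" "p - q \<in> I"
  shows "I +>\<^bsub>monoid_algebra\<^esub> p = I +>\<^bsub>monoid_algebra\<^esub> q"
proof -
  have "r - p \<in> I \<longleftrightarrow> r - q \<in> I" for r
    using pm.subspace_add[OF assms(1), of "r - p" "p - q"] pm.subspace_diff[OF assms(1), of "r - q" "p - q"] assms(2)
    by auto
  then show ?thesis
    by (auto simp: mem_coset_monoid_algebra)
qed

section \<open>Pure tensors in the tensor square of the free algebra\<close>

lemma pure_tensor_sum_left:
  "pure_tensor p q = (\<Sum>v\<in>Poly_Mapping.keys p. pm_scale (Poly_Mapping.lookup p v)
    (\<Sum>w\<in>Poly_Mapping.keys q. pm_scale (Poly_Mapping.lookup q w) (pm_unit (v, w))))"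
  unfolding pure_tensor_def by (simp add: pm.scale_sum_right)

lemma pure_tensor_sum_right:
  "pure_tensor p q = (\<Sum>w\<in>Poly_Mapping.keys q. pm_scale (Poly_Mapping.lookup q w)
    (\<Sum>v\<in>Poly_Mapping.keys p. pm_scale (Poly_Mapping.lookup p v) (pm_unit (v, w))))"
  unfolding pure_tensor_sum_left pm.scale_sum_right
  by (subst sum.swap) (simp add: mult.commute)

lemma linear_pure_tensor_left: "Vector_Spaces.linear pm_scale pm_scale (\<lambda>p. pure_tensor p q)"
  unfolding pure_tensor_sum_left by (rule pm.linear_sum_keys)

lemma linear_pure_tensor_right: "Vector_Spaces.linear pm_scale pm_scale (pure_tensor p)"
  unfolding pure_tensor_sum_right by (rule pm.linear_sum_keys)

lemmas pure_tensor_add_left = linear_pure_tensor_left[unfolded pm_linear_iff, THEN conjunct1, rule_format]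
lemmas pure_tensor_scale_left = linear_pure_tensor_left[unfolded pm_linear_iff, THEN conjunct2, rule_format]
lemmas pure_tensor_add_right = linear_pure_tensor_right[unfolded pm_linear_iff, THEN conjunct1, rule_format]
lemmas pure_tensor_scale_right = linear_pure_tensor_right[unfolded pm_linear_iff, THEN conjunct2, rule_format]

lemma pure_tensor_diff_left: "pure_tensor (p - p') q = pure_tensor p q - pure_tensor p' q"
  using pure_tensor_add_left[of "p - p'" p' q] by (simp add: algebra_simps)

lemma pure_tensor_diff_right: "pure_tensor q (p - p') = pure_tensor q p - pure_tensor q p'"
  using pure_tensor_add_right[of q "p - p'" p'] by (simp add: algebra_simps)

lemma pure_tensor_pm_unit: "pure_tensor (pm_unit v) (pm_unit w) = pm_unit (v, w)"
  by (simp add: pure_tensor_def)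

text \<open>Both sides are bilinear in \<open>p\<close> and \<open>q\<close>, so agreement on pairs
  of basis vectors suffices.\<close>

lemma pm_mult_eqI:
  fixes h :: "('m::monoid_add \<Rightarrow>\<^sub>0 'k::field) \<Rightarrow> ('n::monoid_add \<Rightarrow>\<^sub>0 'k)"
  assumes g: "Vector_Spaces.linear pm_scale pm_scale g" and h: "Vector_Spaces.linear pm_scale pm_scale h"
    and g': "Vector_Spaces.linear pm_scale pm_scale g'"
    and "\<And>u v. g (pm_unit u * pm_unit v) = h (pm_unit u) * g' (pm_unit v)"
  shows "g (p * q) = h p * g' q"
proof -
  note lin = g[unfolded pm_linear_iff] h[unfolded pm_linear_iff] g'[unfolded pm_linear_iff]
  have 1: "g (pm_unit u * q) = h (pm_unit u) * g' q" for u
    by (rule pm.linear_eq_on_pm_unit[where g = "\<lambda>q. g (pm_unit u * q)" and h = "\<lambda>q. h (pm_unit u) * g' q"])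
      (use lin assms(4) in \<open>simp_all add: pm_linear_iff distrib_left pm_scale_mult_right\<close>)
  show ?thesis
    by (rule pm.linear_eq_on_pm_unit[where g = "\<lambda>p. g (p * q)" and h = "\<lambda>p. h p * g' q"])
      (use lin 1 in \<open>simp_all add: pm_linear_iff distrib_right pm_scale_mult_left\<close>)
qed

text \<open>All four elements enter linearly. Replacing them by words one at a time leaves an
  identity between pairs of words.\<close>

lemma pure_tensor_mult: "pure_tensor a b * pure_tensor p q = pure_tensor (a * p) (b * q)"
proof -
  have 1: "pure_tensor (a * p) (b * q) = pure_tensor a b * pure_tensor p q"
    if a: "a = pm_unit u" and b: "b = pm_unit v" for u v a b
  proof -
    have 2: "pure_tensor (a * p) (b * pm_unit w) = pure_tensor a b * pure_tensor p (pm_unit w)" for w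
      unfolding a b
      by (rule pm.linear_eq_on_pm_unit[where g = "\<lambda>p. pure_tensor (pm_unit u * p) (pm_unit v * pm_unit w)"])
        (simp_all add: pm_linear_iff distrib_left distrib_right pure_tensor_add_left pure_tensor_scale_left
          pm_scale_mult_right pure_tensor_pm_unit mult_single)
    show ?thesis
      by (rule pm.linear_eq_on_pm_unit[where g = "\<lambda>q. pure_tensor (a * p) (b * q)"])
        (use 2 in \<open>simp_all add: pm_linear_iff distrib_left pure_tensor_add_right pure_tensor_scale_right
          pm_scale_mult_right\<close>)
  qed
  have 3: "pure_tensor (a * p) (b * q) = pure_tensor a b * pure_tensor p q" if b: "b = pm_unit v" for v b
    by (rule pm.linear_eq_on_pm_unit[where g = "\<lambda>a. pure_tensor (a * p) (b * q)"])
      (use 1 b in \<open>simp_all add: pm_linear_iff distrib_right pure_tensor_add_left pure_tensor_scale_left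
          pm_scale_mult_left\<close>)
  show ?thesis
    by (rule sym, rule pm.linear_eq_on_pm_unit[where g = "\<lambda>b. pure_tensor (a * p) (b * q)"])
      (use 3 in \<open>simp_all add: pm_linear_iff distrib_right pure_tensor_add_right pure_tensor_scale_right
          pm_scale_mult_left\<close>)
qed

section \<open>The coproduct of the free algebra\<close>

abbreviation word_comult :: "'v list \<Rightarrow> ('v list \<times> 'v list) \<Rightarrow>\<^sub>0 'k::field" where
  "word_comult w \<equiv> prod_list (map (\<lambda>x. pure_tensor (gen x) 1 + pure_tensor 1 (gen x)) w)"

lemma linear_free_comult: "Vector_Spaces.linear pm_scale pm_scale free_comult"
  unfolding free_comult_def by (rule pm.linear_sum_keys)

lemmas free_comult_add = linear_free_comult[unfolded pm_linear_iff, THEN conjunct1, rule_format]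
lemmas free_comult_scale = linear_free_comult[unfolded pm_linear_iff, THEN conjunct2, rule_format]

lemma free_comult_zero: "free_comult 0 = 0"
  by (simp add: free_comult_def)

lemma free_comult_diff: "free_comult (p - q) = free_comult p - free_comult q"
  using free_comult_add[of "p - q" q] by (simp add: algebra_simps)

lemma free_comult_pm_unit: "free_comult (pm_unit w) = word_comult w"
  by (simp add: free_comult_def)

lemma free_comult_mult: "free_comult (p * q) = free_comult p * free_comult q"
  by (rule pm_mult_eqI[OF linear_free_comult linear_free_comult linear_free_comult])
    (simp add: mult_single free_comult_pm_unit plus_list_def)

lemma free_comult_gen: "free_comult (gen x) = pure_tensor (gen x) 1 + pure_tensor 1 (gen x)"
  by (simp add: gen_def free_comult_pm_unit)

lemma pure_tensor_one_one: "pure_tensor 1 1 = 1"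
  using pure_tensor_pm_unit[of 0 0] by (simp add: zero_prod_def[symmetric])

lemma pm_unit_Cons: "pm_unit (x # w) = gen x * pm_unit w"
  by (simp add: gen_def mult_single plus_list_def)

lemma pm_unit_append: "pm_unit (v @ w) = pm_unit v * pm_unit w"
  by (simp add: mult_single plus_list_def)

lemma pm_unit_Nil: "pm_unit [] = 1"
  by (metis single_one zero_list_def)

text \<open>In the expanded product each letter of \<open>w\<close> goes to the left or to the right
  tensor factor, so both factors are subsequences of \<open>w\<close>. Word sets closed under
  subsequences thus give subcoalgebras.\<close>

lemma word_comult_in_span_subseqs:
  "word_comult w \<in> pm.span {pure_tensor (pm_unit u) (pm_unit v) | u v. u \<in> set (subseqs w) \<and> v \<in> set (subseqs w)}"
proof (induction w)
  case Nil
  show ?case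
    using pure_tensor_one_one by (auto intro!: pm.span_base simp: pm_unit_Nil)
next
  case (Cons x w)
  let ?S = "\<lambda>w. {pure_tensor (pm_unit u) (pm_unit v) | u v. u \<in> set (subseqs w) \<and> v \<in> set (subseqs w)}"
  have "(pure_tensor (gen x) 1 + pure_tensor 1 (gen x)) * y \<in> pm.span (?S (x # w))"
    if "y \<in> pm.span (?S w)" for y
    using that
  proof (induction rule: pm.span_induct_alt)
    case base
    show ?case
      by (simp add: pm.span_zero)
  next
    case (step c y z)
    then obtain u v where uv: "u \<in> set (subseqs w)" "v \<in> set (subseqs w)"
      "y = pure_tensor (pm_unit u) (pm_unit v)"
      by blast
    have "(pure_tensor (gen x) 1 + pure_tensor 1 (gen x)) * y =
        pure_tensor (pm_unit (x # u)) (pm_unit v) + pure_tensor (pm_unit u) (pm_unit (x # v))"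
      by (simp add: uv(3) distrib_right pure_tensor_mult pm_unit_Cons)
    also have "\<dots> \<in> pm.span (?S (x # w))"
      using uv(1,2) by (intro pm.span_add pm.span_base) (force simp: Let_def)+
    finally show ?case
      using step.IH by (simp only: distrib_left pm_scale_mult_right pm.span_add pm.span_scale)
  qed
  then show ?case
    using Cons by simp
qed

section \<open>The universal enveloping algebra as a Hopf algebra\<close>

context lie_algebra
begin

lemma env_relations_subset: "env_relations \<subseteq> env_ideal"
  unfolding env_ideal_def
  by (rule ring.genideal_self[OF ring_monoid_algebra]) (simp add: monoid_algebra_def)

lemma ideal_env_ideal: "ideal env_ideal monoid_algebra"
  unfolding env_ideal_def
  by (rule ring.genideal_ideal[OF ring_monoid_algebra]) (simp add: monoid_algebra_def)

lemma env_ideal_mult_left: "p \<in> env_ideal \<Longrightarrow> q * p \<in> env_ideal"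
  and env_ideal_mult_right: "p \<in> env_ideal \<Longrightarrow> p * q \<in> env_ideal"
  using ideal.I_l_closed[OF ideal_env_ideal, of p q] ideal.I_r_closed[OF ideal_env_ideal, of p q]
  by (auto simp: monoid_algebra_def)

lemma subspace_env_ideal: "pm.subspace env_ideal"
proof (rule pm.subspaceI)
  interpret additive_subgroup env_ideal monoid_algebra
    by (rule ideal.axioms(1)[OF ideal_env_ideal])
  show "0 \<in> env_ideal"
    using zero_closed by (simp add: monoid_algebra_def)
  show "p + q \<in> env_ideal" if "p \<in> env_ideal" "q \<in> env_ideal" for p q
    using a_closed[OF that] by (simp add: monoid_algebra_def)
  show "pm_scale c p \<in> env_ideal" if "p \<in> env_ideal" for c p
    using env_ideal_mult_left[OF that] by (simp add: mult_map_scale_conv_mult)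
qed

lemmas env_ideal_closed = pm.subspace_0[OF subspace_env_ideal] pm.subspace_add[OF subspace_env_ideal]
  pm.subspace_diff[OF subspace_env_ideal] pm.subspace_scale[OF subspace_env_ideal]
  pm.subspace_neg[OF subspace_env_ideal] pm.subspace_sum[OF subspace_env_ideal]

lemma env_ideal_minimal:
  assumes "pm.subspace J" "\<And>p q. p \<in> J \<Longrightarrow> q * p \<in> J" "\<And>p q. p \<in> J \<Longrightarrow> p * q \<in> J"
    and "env_relations \<subseteq> J"
  shows "env_ideal \<subseteq> J"
proof -
  have "additive_subgroup J monoid_algebra"
  proof -
    have "subgroup J (add_monoid monoid_algebra)"
    proof (rule group.subgroupI)
      show "Group.group (add_monoid (monoid_algebra :: ('k, 'v list \<Rightarrow>\<^sub>0 'k) module))"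
        using abelian_group.a_group[OF ring.is_abelian_group[OF ring_monoid_algebra]] .
      show "inv\<^bsub>add_monoid monoid_algebra\<^esub> p \<in> J" if "p \<in> J" for p
      proof -
        have "inv\<^bsub>add_monoid monoid_algebra\<^esub> p = - p"
          by (rule group.inv_equality[OF \<open>Group.group (add_monoid monoid_algebra)\<close>])
            (auto simp: monoid_algebra_def)
        then show ?thesis
          using pm.subspace_neg[OF assms(1) that] by simp
      qed
    qed (use assms(1) pm.subspace_0 pm.subspace_add in \<open>auto simp: monoid_algebra_def\<close>)
    then show ?thesis
      by (simp add: additive_subgroup_def)
  qed
  then have "ideal J monoid_algebra"
    by (intro ideal.intro ring_monoid_algebra ideal_axioms.intro)
      (use assms in \<open>auto simp: monoid_algebra_def\<close>)
  then show ?thesis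
    using ring.genideal_minimal[OF ring_monoid_algebra] assms(4) by (auto simp: env_ideal_def)
qed

lemma gen_add: "gen (x + y) - gen x - gen y \<in> env_ideal"
  by (rule subsetD[OF env_relations_subset]) (unfold env_relations_def, blast)

lemma gen_scale: "gen (c *s x) - pm_scale c (gen x) \<in> env_ideal"
  by (rule subsetD[OF env_relations_subset]) (unfold env_relations_def, blast)

lemma gen_bracket: "gen x * gen y - gen y * gen x - gen (bracket x y) \<in> env_ideal"
  by (rule subsetD[OF env_relations_subset]) (unfold env_relations_def, blast)

text \<open>The empty word splits only into two empty words. The constant coefficient is thus the
  augmentation of the free algebra.\<close>

lemma lookup_Nil_mult:
  "Poly_Mapping.lookup (p * q) [] = Poly_Mapping.lookup p [] * Poly_Mapping.lookup q []"
  for p q :: "'c list \<Rightarrow>\<^sub>0 'd::field"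
proof -
  have "(\<Sum>r. Poly_Mapping.lookup q r when [] = l + r) = (Poly_Mapping.lookup q [] when l = [])"
    for l :: "'c list"
    by (cases l) (simp_all add: plus_list_def eq_commute[of "[]"])
  then show ?thesis
    by (simp add: lookup_mult mult_when)
qed

text \<open>The augmentation kills every relation, hence the whole ideal, but takes the value 1 at
  1.\<close>

lemma one_notin_env_ideal: "1 \<notin> env_ideal"
proof -
  have "env_ideal \<subseteq> {p. Poly_Mapping.lookup p [] = 0}"
  proof (rule env_ideal_minimal)
    show "pm.subspace {p :: 'v list \<Rightarrow>\<^sub>0 'k. Poly_Mapping.lookup p [] = 0}"
      by (rule pm.subspaceI) (auto simp: lookup_add)
    show "env_relations \<subseteq> {p. Poly_Mapping.lookup p [] = 0}"
      by (auto simp: env_relations_def lookup_minus gen_def lookup_single lookup_Nil_mult)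
  qed (auto simp: lookup_Nil_mult)
  then show ?thesis
    by (auto simp: lookup_one zero_list_def)
qed

abbreviation env_class :: "('v list \<Rightarrow>\<^sub>0 'k) \<Rightarrow> ('v list \<Rightarrow>\<^sub>0 'k) set" where
  "env_class p \<equiv> env_ideal +>\<^bsub>monoid_algebra\<^esub> p"

lemma env_class_eqI: "p - q \<in> env_ideal \<Longrightarrow> env_class p = env_class q"
  by (rule coset_monoid_algebra_eqI[OF subspace_env_ideal])

lemma env_class_eqD: "env_class p = env_class q \<Longrightarrow> p - q \<in> env_ideal"
  using mem_coset_monoid_algebra[of p env_ideal p] mem_coset_monoid_algebra[of p env_ideal q]
    env_ideal_closed(1) by auto

sublocale env: onto_module pm_scale UNIV env_class env_algebra
  unfolding env_algebra_def by (rule onto_quotient_monoid_algebra[OF subspace_env_ideal])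

lemma env_mult: "env_class p \<otimes>\<^bsub>env_algebra\<^esub> env_class q = env_class (p * q)"
  using ideal.rcoset_mult_add[OF ideal_env_ideal, of p q]
  by (simp add: env_algebra_def quotient_module_def monoid_algebra_def)

section \<open>The tensor square and the descent of the coproduct\<close>

abbreviation tensor_relations :: "(('v list \<times> 'v list) \<Rightarrow>\<^sub>0 'k) set" where
  "tensor_relations \<equiv> {pure_tensor p q | p q. p \<in> env_ideal \<or> q \<in> env_ideal}"

lemma env_tensor_ideal_eq_span: "env_tensor_ideal = pm.span tensor_relations"
  unfolding env_tensor_ideal_def
  using onto_module.span_image[OF onto_monoid_algebra, of tensor_relations] by simp

lemma subspace_env_tensor_ideal: "pm.subspace env_tensor_ideal"
  by (simp add: env_tensor_ideal_eq_span)

lemma pure_tensor_in_env_tensor_ideal: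
  "p \<in> env_ideal \<or> q \<in> env_ideal \<Longrightarrow> pure_tensor p q \<in> env_tensor_ideal"
  unfolding env_tensor_ideal_eq_span by (rule pm.span_base) blast

text \<open>A basis vector \<open>pm_unit k\<close> is a pure tensor of two words, so multiplying by
  it preserves the generators of the span because \<open>env_ideal\<close> is two-sided. Linearity
  extends this to arbitrary \<open>y\<close>.\<close>

lemma env_tensor_ideal_mult:
  assumes "x \<in> env_tensor_ideal"
  shows "y * x \<in> env_tensor_ideal" "x * y \<in> env_tensor_ideal"
proof -
  have unit: "pm_unit k * x \<in> env_tensor_ideal \<and> x * pm_unit k \<in> env_tensor_ideal" for k
    using assms unfolding env_tensor_ideal_eq_span
  proof (induction rule: pm.span_induct_alt)
    case base
    show ?case
      by (simp add: pm.span_zero)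
  next
    case (step c x z)
    obtain u v where k: "(pm_unit k :: ('v list \<times> 'v list) \<Rightarrow>\<^sub>0 'k) = pure_tensor (pm_unit u) (pm_unit v)"
      by (cases k) (metis pure_tensor_pm_unit)
    obtain p q where x: "x = pure_tensor p q" "p \<in> env_ideal \<or> q \<in> env_ideal"
      using step by blast
    have "pm_unit k * x \<in> pm.span tensor_relations" "x * pm_unit k \<in> pm.span tensor_relations"
      unfolding k x(1) pure_tensor_mult using x(2)
      by (auto intro!: pm.span_base intro: env_ideal_mult_left env_ideal_mult_right)
    then show ?case
      using step.IH
      by (auto simp: distrib_left distrib_right pm_scale_mult_left pm_scale_mult_right
          intro: pm.span_add pm.span_scale)
  qed
  have "y \<in> pm.span (range pm_unit)"
    by (simp add: span_pm_unit)
  then have "y * x \<in> env_tensor_ideal \<and> x * y \<in> env_tensor_ideal"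
  proof (induction rule: pm.span_induct_alt)
    case base
    show ?case
      by (simp add: pm.subspace_0 subspace_env_tensor_ideal)
  next
    case (step c y z)
    then show ?case
      using unit by (auto simp: distrib_left distrib_right pm_scale_mult_left pm_scale_mult_right
          intro!: pm.subspace_add[OF subspace_env_tensor_ideal] pm.subspace_scale[OF subspace_env_tensor_ideal])
  qed
  then show "y * x \<in> env_tensor_ideal" "x * y \<in> env_tensor_ideal"
    by blast+
qed

text \<open>Each relation is primitive: it is either linear in the generators or a commutator of
  primitive elements minus a generator. As the coproduct is multiplicative, the preimage of
  \<open>env_tensor_ideal\<close> is an ideal containing the relations.\<close>

lemma free_comult_env_ideal:
  assumes "p \<in> env_ideal"
  shows "free_comult p \<in> env_tensor_ideal"
proof -
  have prim: "pure_tensor r 1 + pure_tensor 1 r \<in> env_tensor_ideal" if "r \<in> env_ideal" for r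
    using that by (intro pm.subspace_add[OF subspace_env_tensor_ideal] pure_tensor_in_env_tensor_ideal) auto
  have "env_ideal \<subseteq> {p. free_comult p \<in> env_tensor_ideal}"
  proof (rule env_ideal_minimal)
    show "pm.subspace {p. free_comult p \<in> env_tensor_ideal}"
      by (rule pm.subspaceI) (auto simp: free_comult_add free_comult_scale
          pm.subspace_add[OF subspace_env_tensor_ideal] pm.subspace_scale[OF subspace_env_tensor_ideal]
          pm.subspace_0[OF subspace_env_tensor_ideal] free_comult_zero)
    show "env_relations \<subseteq> {p. free_comult p \<in> env_tensor_ideal}"
    proof
      fix r assume r: "r \<in> env_relations"
      have "free_comult r = pure_tensor r 1 + pure_tensor 1 r"
        using r unfolding env_relations_def
        by (auto simp: free_comult_diff free_comult_gen free_comult_scale free_comult_mult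
            pure_tensor_diff_left pure_tensor_diff_right pure_tensor_scale_left pure_tensor_scale_right
            distrib_left distrib_right pure_tensor_mult pm.scale_right_distrib)
      then show "r \<in> {p. free_comult p \<in> env_tensor_ideal}"
        using prim r env_relations_subset by auto
    qed
  qed (auto simp: free_comult_mult env_tensor_ideal_mult)
  then show ?thesis
    using assms by blast
qed

abbreviation tensor_class where
  "tensor_class x \<equiv> env_tensor_ideal +>\<^bsub>monoid_algebra\<^esub> x"

lemma tensor_class_eqI: "x - y \<in> env_tensor_ideal \<Longrightarrow> tensor_class x = tensor_class y"
  by (rule coset_monoid_algebra_eqI[OF subspace_env_tensor_ideal])

sublocale tensor: onto_module pm_scale UNIV tensor_class env_tensor_square
  unfolding env_tensor_square_def by (rule onto_quotient_monoid_algebra[OF subspace_env_tensor_ideal])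

lemma env_comult_class: "env_comult (env_class p) = tensor_class (free_comult p)"
proof -
  have "tensor_class (free_comult p') = tensor_class (free_comult p)" if "p' \<in> env_class p" for p'
    using that free_comult_env_ideal[of "p' - p"]
    by (intro tensor_class_eqI) (simp add: mem_coset_monoid_algebra free_comult_diff)
  moreover have "p \<in> env_class p"
    by (simp add: mem_coset_monoid_algebra env_ideal_closed)
  ultimately show ?thesis
    unfolding env_comult_def by blast
qed

lemma env_tensor_class: "env_tensor (env_class p) (env_class q) = tensor_class (pure_tensor p q)"
proof -
  have "tensor_class (pure_tensor p' q') = tensor_class (pure_tensor p q)"
    if "p' \<in> env_class p" "q' \<in> env_class q" for p' q'
  proof (rule tensor_class_eqI)
    have "pure_tensor p' q' - pure_tensor p q = pure_tensor (p' - p) q' + pure_tensor p (q' - q)"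
      by (simp add: pure_tensor_diff_left pure_tensor_diff_right)
    also have "\<dots> \<in> env_tensor_ideal"
      using that by (intro pm.subspace_add[OF subspace_env_tensor_ideal] pure_tensor_in_env_tensor_ideal)
        (simp_all add: mem_coset_monoid_algebra)
    finally show "pure_tensor p' q' - pure_tensor p q \<in> env_tensor_ideal" .
  qed
  moreover have "p \<in> env_class p" "q \<in> env_class q"
    by (simp_all add: mem_coset_monoid_algebra env_ideal_closed)
  ultimately show ?thesis
    unfolding env_tensor_def by blast
qed

text \<open>The coproduct of a word is a combination of tensors of its subsequences, which stay in
  \<open>W\<close>; taking classes carries this over to the enveloping algebra.\<close>

lemma subcoalgebra_span_words:
  assumes "\<And>u w. w \<in> W \<Longrightarrow> u \<in> set (subseqs w) \<Longrightarrow> u \<in> W"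
  shows "subcoalgebra (env_class ` pm.span (pm_unit ` W))"
  unfolding subcoalgebra_def
proof (intro conjI ballI)
  let ?E = "pm.span (pm_unit ` W) :: ('v list \<Rightarrow>\<^sub>0 'k) set"
  show "VectorSpace.subspace class_ring (env_class ` ?E) env_algebra"
    by (rule env.subspace_image) auto
  have comult: "free_comult p \<in> pm.span {pure_tensor a b | a b. a \<in> ?E \<and> b \<in> ?E}" if "p \<in> ?E" for p
    using that
  proof (induction rule: pm.span_induct_alt)
    case base
    show ?case
      by (simp add: free_comult_zero pm.span_zero)
  next
    case (step c x y)
    then obtain w where w: "w \<in> W" "x = pm_unit w"
      by blast
    have "word_comult w \<in> pm.span {pure_tensor a b | a b. a \<in> ?E \<and> b \<in> ?E}"
      by (rule subsetD[OF pm.span_mono word_comult_in_span_subseqs])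
        (use w(1) assms in \<open>blast intro: pm.span_base\<close>)
    then show ?case
      using step.IH by (simp add: w free_comult_add free_comult_scale free_comult_pm_unit pm.span_add pm.span_scale
          del: map_single)
  qed
  fix C assume "C \<in> env_class ` ?E"
  then obtain p where p: "p \<in> ?E" "C = env_class p"
    by blast
  have "env_comult C \<in> tensor_class ` pm.span {pure_tensor a b | a b. a \<in> ?E \<and> b \<in> ?E}"
    using comult[OF p(1)] by (simp add: p(2) env_comult_class)
  also have "\<dots> = LinearCombinations.module.span class_ring env_tensor_square
      (tensor_class ` {pure_tensor a b | a b. a \<in> ?E \<and> b \<in> ?E})"
    by (rule tensor.span_image) simp
  also have "tensor_class ` {pure_tensor a b | a b. a \<in> ?E \<and> b \<in> ?E} =
      {env_tensor A B | A B. A \<in> env_class ` ?E \<and> B \<in> env_class ` ?E}"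
    by (force simp: env_tensor_class)
  finally show "env_comult C \<in> LinearCombinations.module.span class_ring env_tensor_square
      {env_tensor A B | A B. A \<in> env_class ` ?E \<and> B \<in> env_class ` ?E}" .
qed

lemma env_act_image:
  "env_act F (env_class ` E) = env_class ` pm.span {gen f * e | f e. f \<in> F \<and> e \<in> E}"
proof -
  have "{env_inj f \<otimes>\<^bsub>env_algebra\<^esub> e | f e. f \<in> F \<and> e \<in> env_class ` E} =
      env_class ` {gen f * e | f e. f \<in> F \<and> e \<in> E}"
    by (force simp: env_inj_def env_mult)
  then show ?thesis
    unfolding env_act_def by (simp add: env.span_image)
qed

lemma env_set_add_image:
  "env_class ` A <+>\<^bsub>env_algebra\<^esub> env_class ` B = env_class ` {a + b | a b. a \<in> A \<and> b \<in> B}"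
  by (force simp: set_add_defs env.map_add)

text \<open>The image of the projection is a complement of the ideal: it carries a copy of the enveloping
  algebra on which dimensions can be computed inside the free algebra.\<close>

lemma env_ideal_projection:
  "\<exists>\<rho>. Vector_Spaces.linear pm_scale pm_scale \<rho> \<and> (\<forall>p. p - \<rho> p \<in> env_ideal) \<and> (\<forall>p\<in>env_ideal. \<rho> p = 0)"
proof -
  obtain B where B: "B \<subseteq> env_ideal" "pm.independent B" "env_ideal \<subseteq> pm.span B"
    using pm.basis_exists[of env_ideal] by metis
  obtain C where C: "B \<subseteq> C" "pm.independent C" "UNIV \<subseteq> pm.span C"
    using pm.maximal_independent_subset_extend[of B UNIV] B by auto
  interpret pp: vector_space_pair "pm_scale :: 'k \<Rightarrow> ('v list \<Rightarrow>\<^sub>0 'k) \<Rightarrow> _" "pm_scale :: 'k \<Rightarrow> ('v list \<Rightarrow>\<^sub>0 'k) \<Rightarrow> _" ..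
  obtain \<rho> where \<rho>: "Vector_Spaces.linear pm_scale pm_scale \<rho>" "\<forall>x\<in>C. \<rho> x = (if x \<in> B then 0 else x)"
    using pp.linear_independent_extend[OF C(2), of "\<lambda>x. if x \<in> B then 0 else x"] by blast
  interpret \<rho>: Vector_Spaces.linear pm_scale pm_scale \<rho>
    by (rule \<rho>(1))
  have "\<rho> p = 0" if "p \<in> pm.span B" for p
    using that
  proof (induction rule: pm.span_induct_alt)
    case (step c x y)
    then show ?case
      using \<rho>(2) C(1) by (auto simp: \<rho>.add \<rho>.scale)
  qed (simp add: \<rho>.zero)
  moreover have "p - \<rho> p \<in> env_ideal" if "p \<in> pm.span C" for p
    using that
  proof (induction rule: pm.span_induct_alt)
    case (step c x y)
    have "x - \<rho> x \<in> env_ideal"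
      using step(1) \<rho>(2) B(1) env_ideal_closed(1) by auto
    then have "pm_scale c (x - \<rho> x) + (y - \<rho> y) \<in> env_ideal"
      by (rule env_ideal_closed(2)[OF env_ideal_closed(4) step.IH])
    then show ?case
      by (simp add: \<rho>.add \<rho>.scale pm.scale_right_diff_distrib algebra_simps)
  qed (simp add: \<rho>.zero env_ideal_closed)
  ultimately show ?thesis
    using \<rho>(1) B(3) C(3) by blast
qed

end

section \<open>A criterion for amenability\<close>

text \<open>Divided by \<open>(1 + \<epsilon>) ^ n\<close>, the left side tends to 0.\<close>

lemma linear_less_power:
  fixes c \<epsilon> :: real
  assumes "0 < \<epsilon>"
  shows "\<exists>n. c * (real n + 1) < (1 + \<epsilon>) ^ n"
proof -
  define x where "x = 1 / (1 + \<epsilon>)"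
  have x: "norm x < 1" "0 < x" "x * (1 + \<epsilon>) = 1"
    using assms by (auto simp: x_def field_simps)
  have "(\<lambda>n. c * (of_nat n * x ^ n + x ^ n)) \<longlonglongrightarrow> c * (0 + 0)"
    by (intro tendsto_mult_left tendsto_add powser_times_n_limit_0 LIMSEQ_power_zero x(1))
  then have "\<forall>\<^sub>F n in sequentially. c * (of_nat n * x ^ n + x ^ n) < 1"
    by (intro order_tendstoD(2)) auto
  then obtain n where "c * (of_nat n * x ^ n + x ^ n) < 1"
    by (meson eventually_sequentially order_refl)
  then have "c * (real n + 1) * x ^ n < (1 + \<epsilon>) ^ n * x ^ n"
    using x(3) by (simp add: algebra_simps flip: power_mult_distrib)
  then show ?thesis
    using x(2) by (intro exI[of _ n]) (simp add: mult_less_cancel_right)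
qed

text \<open>Doubling over every interval of length \<open>n\<close> would force
  \<open>2 ^ k \<le> e (k * n)\<close>, exponential growth against a polynomial bound.\<close>

lemma not_doubling_if_polynomial:
  fixes e :: "nat \<Rightarrow> nat"
  assumes pos: "0 < e 0" and bound: "\<And>m. e m \<le> (m + 1) ^ s" and "0 < n"
  shows "\<exists>m. e (m + n) < 2 * e m"
proof (rule ccontr)
  assume "\<not> ?thesis"
  then have *: "2 * e m \<le> e (m + n)" for m
    by (meson not_less)
  have pow: "2 ^ k \<le> e (k * n)" for k
  proof (induction k)
    case (Suc k)
    then show ?case
      using *[of "k * n"] by (simp add: add.commute)
  qed (use pos in simp)
  \<comment> \<open>The comparison is made at \<open>k = s * j\<close>: the lower bound is
    \<open>(2 ^ j) ^ s\<close> and the upper bound \<open>(s * j * n + 1) ^ s\<close>, so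
    \<open>j\<close> has to satisfy \<open>s * j * n + 1 < 2 ^ j\<close>.\<close>
  obtain j where "real (s * n + 1) * (real j + 1) < (1 + 1) ^ j"
    using linear_less_power[of 1 "real (s * n + 1)"] by auto
  then have "real ((s * n + 1) * (j + 1)) < real (2 ^ j)"
    by (simp add: algebra_simps)
  then have j: "s * j * n + 1 < 2 ^ j"
    unfolding of_nat_less_iff by (simp add: algebra_simps)
  show False
  proof (cases "s = 0")
    case True
    then show False
      using pow[of 1] bound[of n] by simp
  next
    case False
    have "2 ^ (s * j) \<le> (s * j * n + 1) ^ s"
      using pow[of "s * j"] bound[of "s * j * n"] by linarith
    also have "\<dots> < (2 ^ j) ^ s"
      using j False by (intro power_strict_mono) auto
    finally show False
      by (simp add: power_mult[symmetric] mult.commute)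
  qed
qed

text \<open>A basis of \<open>V\<close> spans \<open>U\<close> as well. It is finite because of
  \<open>G\<close>; an infinite basis would have \<open>card\<close> equal to 0.\<close>

lemma (in vector_space) dim_mono_finite:
  assumes "U \<subseteq> span V" "V \<subseteq> span G" "finite G"
  shows "dim U \<le> dim V"
proof -
  obtain B where B: "B \<subseteq> V" "independent B" "V \<subseteq> span B" "card B = dim V"
    by (rule basis_exists)
  have "finite B"
    using independent_span_bound[OF assms(3) B(2)] B(1) assms(2) by blast
  moreover have "U \<subseteq> span B"
    using assms(1) B(3) span_minimal[OF B(3) subspace_span] by blast
  ultimately show ?thesis
    using dim_le_card B(4) by metis
qed

text \<open>A multiset over \<open>B\<close> is determined by its multiplicities on
  \<open>B\<close>, each of which is at most \<open>M\<close>.\<close>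

lemma card_multisets_size_le:
  assumes "finite B"
  shows "finite {\<mu>. set_mset \<mu> \<subseteq> B \<and> size \<mu> \<le> M}"
    "card {\<mu>. set_mset \<mu> \<subseteq> B \<and> size \<mu> \<le> M} \<le> (M + 1) ^ card B"
proof -
  let ?S = "{\<mu>. set_mset \<mu> \<subseteq> B \<and> size \<mu> \<le> M}" and ?g = "\<lambda>\<mu>. restrict (count \<mu>) B"
  have fin: "finite (B \<rightarrow>\<^sub>E {..M})"
    using assms by (intro finite_PiE) auto
  have sub: "?g ` ?S \<subseteq> B \<rightarrow>\<^sub>E {..M}"
    by (auto intro: order_trans[OF count_le_size])
  have inj: "inj_on ?g ?S"
  proof (rule inj_onI, rule multiset_eqI)
    fix \<mu> \<nu> x assume "\<mu> \<in> ?S" "\<nu> \<in> ?S" "?g \<mu> = ?g \<nu>"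
    then show "count \<mu> x = count \<nu> x"
      by (cases "x \<in> B") (metis restrict_apply', metis (mono_tags, lifting) mem_Collect_eq not_in_iff subsetD)
  qed
  show "finite ?S"
    using finite_imageD[OF finite_subset[OF sub fin] inj] .
  show "card ?S \<le> (M + 1) ^ card B"
    using card_inj_on_le[OF inj sub fin] by (simp add: card_PiE assms)
qed

lemma pm_span_mult_subset:
  fixes p q :: "'m::monoid_add \<Rightarrow>\<^sub>0 'k::field"
  assumes U: "pm.subspace U" and PQ: "\<And>a b. a \<in> P \<Longrightarrow> b \<in> Q \<Longrightarrow> a * b \<in> U"
    and p: "p \<in> pm.span P" and q: "q \<in> pm.span Q"
  shows "p * q \<in> U"
proof -
  have "P \<subseteq> {a. \<forall>b\<in>pm.span Q. a * b \<in> U}"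
  proof
    fix a assume a: "a \<in> P"
    have "pm.span Q \<subseteq> {b. a * b \<in> U}"
      by (rule pm.span_minimal)
        (use PQ a U in \<open>auto intro!: pm.subspaceI simp: pm.subspace_0 distrib_left pm.subspace_add pm.subspace_scale
          pm_scale_mult_right\<close>)
    then show "a \<in> {a. \<forall>b\<in>pm.span Q. a * b \<in> U}"
      by blast
  qed
  then have "pm.span P \<subseteq> {a. \<forall>b\<in>pm.span Q. a * b \<in> U}"
    by (rule pm.span_minimal)
      (use U in \<open>auto intro!: pm.subspaceI simp: pm.subspace_0 distrib_right pm.subspace_add pm.subspace_scale
          pm_scale_mult_left\<close>)
  then show ?thesis
    using p q by blast
qed

section \<open>Spans of words modulo the relations\<close>

context lie_algebra
begin

text \<open>Adding the ideal to the span allows computing in the free algebra: \<open>p\<close> is a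
  member exactly if its class is a combination of classes of words in \<open>W\<close>.\<close>

definition env_span :: "'v list set \<Rightarrow> ('v list \<Rightarrow>\<^sub>0 'k) set" where
  "env_span W = pm.span (pm_unit ` W \<union> env_ideal)"

lemma subspace_env_span: "pm.subspace (env_span W)"
  by (simp add: env_span_def)

lemmas env_span_closed = pm.subspace_0[OF subspace_env_span] pm.subspace_add[OF subspace_env_span]
  pm.subspace_diff[OF subspace_env_span] pm.subspace_scale[OF subspace_env_span]
  pm.subspace_neg[OF subspace_env_span]

lemma env_span_unit: "w \<in> W \<Longrightarrow> pm_unit w \<in> env_span W"
  unfolding env_span_def by (rule pm.span_base) blast

lemma env_span_ideal: "p \<in> env_ideal \<Longrightarrow> p \<in> env_span W"
  unfolding env_span_def by (rule pm.span_base) blast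

lemma env_span_mono: "W \<subseteq> W' \<Longrightarrow> env_span W \<subseteq> env_span W'"
  unfolding env_span_def by (rule pm.span_mono) blast

lemma span_subset_env_span: "pm.span (pm_unit ` W) \<subseteq> env_span W"
  unfolding env_span_def by (rule pm.span_mono) blast

lemma env_span_minimal:
  assumes "\<And>w. w \<in> W \<Longrightarrow> pm_unit w \<in> env_span W'"
  shows "env_span W \<subseteq> env_span W'"
  unfolding env_span_def[of W]
  by (rule pm.span_minimal) (use assms env_span_ideal subspace_env_span in auto)

lemma env_span_mult_left:
  assumes "\<And>w. w \<in> W \<Longrightarrow> q * pm_unit w \<in> env_span W'" "p \<in> env_span W"
  shows "q * p \<in> env_span W'"
proof (rule pm_span_mult_subset[where P = "{q}" and Q = "pm_unit ` W \<union> env_ideal"])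
  show "q \<in> pm.span {q}" "p \<in> pm.span (pm_unit ` W \<union> env_ideal)"
    using assms(2) by (auto simp: env_span_def intro: pm.span_base)
qed (use assms(1) subspace_env_span env_span_ideal env_ideal_mult_left in auto)

lemma gen_zero: "gen 0 \<in> env_ideal"
  using env_ideal_closed(5)[OF gen_add[of 0 0]] by simp

lemma gen_in_span:
  assumes "x \<in> span B"
  shows "gen x \<in> env_span ((\<lambda>b. [b]) ` B)"
  using assms
proof (induction rule: span_induct_alt)
  case base
  show ?case
    by (rule env_span_ideal[OF gen_zero])
next
  case (step c x y)
  have "gen x \<in> env_span ((\<lambda>b. [b]) ` B)"
    unfolding gen_def by (rule env_span_unit) (use step in blast)
  then have "(gen (c *s x + y) - gen (c *s x) - gen y) + (gen (c *s x) - pm_scale c (gen x)) +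
      pm_scale c (gen x) + gen y \<in> env_span ((\<lambda>b. [b]) ` B)"
    by (intro env_span_closed(2) env_span_ideal[OF gen_add] env_span_ideal[OF gen_scale] env_span_closed(4) step(2))
  then show ?case
    by simp
qed

section \<open>Left multiplication on words in \<open>B\<close> with a prefix of letters
  \<open>t\<close>\<close>

definition prefixed_words :: "'v \<Rightarrow> 'v set \<Rightarrow> nat \<Rightarrow> nat \<Rightarrow> 'v list set" where
  "prefixed_words t B N M = {replicate i t @ w | i w. i \<le> N \<and> length w \<le> M \<and> set w \<subseteq> B}"

lemma finite_prefixed_words:
  assumes "finite B"
  shows "finite (prefixed_words t B N M)"
proof -
  have "prefixed_words t B N M = (\<Union>i\<in>{..N}. (@) (replicate i t) ` {w. set w \<subseteq> B \<and> length w \<le> M})"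
    by (auto simp: prefixed_words_def)
  then show ?thesis
    using finite_lists_length_le[OF assms] by simp
qed

lemma prefixed_words_mono: "N \<le> N' \<Longrightarrow> M \<le> M' \<Longrightarrow> prefixed_words t B N M \<subseteq> prefixed_words t B N' M'"
  by (fastforce simp: prefixed_words_def)

lemma prefixed_words_Cons: "w \<in> prefixed_words t B N M \<Longrightarrow> t # w \<in> prefixed_words t B (Suc N) M"
  unfolding prefixed_words_def by (force intro: exI[of _ "Suc i" for i])

lemma prefixed_words_0: "prefixed_words t B 0 M = {w. length w \<le> M \<and> set w \<subseteq> B}"
  by (auto simp: prefixed_words_def)

text \<open>Dropping letters only shortens the prefix or the rest. By
  \<open>subcoalgebra_span_words\<close> these words therefore span a subcoalgebra.\<close>

lemma subseqs_prefixed_words: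
  assumes "w \<in> prefixed_words t B N M" "u \<in> set (subseqs w)"
  shows "u \<in> prefixed_words t B N M"
proof -
  have base: "length u \<le> length w \<and> set u \<subseteq> set w" if "u \<in> set (subseqs w)" for u w :: "'v list"
    using that by (induction w arbitrary: u) (fastforce simp: Let_def)+
  have "u \<in> prefixed_words t B i M"
    if "u \<in> set (subseqs (replicate i t @ w))" "length w \<le> M" "set w \<subseteq> B" for i u w
    using that
  proof (induction i arbitrary: u)
    case 0
    then show ?case
      using base[of u w] by (auto simp: prefixed_words_0)
  next
    case (Suc i)
    then show ?case
      using prefixed_words_Cons prefixed_words_mono[of i "Suc i" M M t B] by (auto simp: Let_def)
  qed
  then show ?thesis
    using assms prefixed_words_mono[of _ N M M t B] unfolding prefixed_words_def[of t B N] by blast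
qed

lemma gen_mult_env_span_words:
  assumes "x \<in> span B" "p \<in> env_span (prefixed_words t B 0 M)"
  shows "gen x * p \<in> env_span (prefixed_words t B 0 (Suc M))"
proof (rule pm_span_mult_subset[where P = "pm_unit ` (\<lambda>b. [b]) ` B \<union> env_ideal"
      and Q = "pm_unit ` prefixed_words t B 0 M \<union> env_ideal"])
  show "gen x \<in> pm.span (pm_unit ` (\<lambda>b. [b]) ` B \<union> env_ideal)"
    using gen_in_span[OF assms(1)] by (simp add: env_span_def)
  show "p \<in> pm.span (pm_unit ` prefixed_words t B 0 M \<union> env_ideal)"
    using assms(2) by (simp add: env_span_def)
  fix a b assume a: "a \<in> pm_unit ` (\<lambda>b. [b]) ` B \<union> env_ideal"
    and b: "b \<in> pm_unit ` prefixed_words t B 0 M \<union> env_ideal"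
  show "a * b \<in> env_span (prefixed_words t B 0 (Suc M))"
  proof (cases "a \<in> env_ideal \<or> b \<in> env_ideal")
    case True
    then show ?thesis
      using env_ideal_mult_left env_ideal_mult_right env_span_ideal by blast
  next
    case False
    then obtain c w where "c \<in> B" "w \<in> prefixed_words t B 0 M" "a = pm_unit [c]" "b = pm_unit w"
      using a b by auto
    then show ?thesis
      by (auto simp: pm_unit_append[symmetric] prefixed_words_0 intro!: env_span_unit)
  qed
qed (rule subspace_env_span)

lemma gen_mult_env_span:
  assumes "p \<in> env_span (prefixed_words t B N M)"
  shows "gen t * p \<in> env_span (prefixed_words t B (Suc N) M)"
  by (rule env_span_mult_left[OF _ assms])
    (auto simp: pm_unit_Cons[symmetric] intro!: env_span_unit prefixed_words_Cons)

text \<open>Modulo the relations, \<open>y t = t y + [y, t]\<close>. Moving \<open>y\<close> through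
  the prefix produces iterated brackets of \<open>y\<close> with \<open>t\<close> of order at most
  \<open>i\<close>. They lie in the span of \<open>B\<close>, so each adds one letter behind the
  prefix.\<close>

lemma gen_mult_prefixed_word:
  assumes "\<And>j. j \<le> i \<Longrightarrow> ((\<lambda>x. bracket x t) ^^ j) y \<in> span B" "length w \<le> M" "set w \<subseteq> B"
  shows "gen y * pm_unit (replicate i t @ w) \<in> env_span (prefixed_words t B i (Suc M))"
  using assms(1)
proof (induction i arbitrary: y)
  case 0
  have "pm_unit w \<in> env_span (prefixed_words t B 0 M)"
    by (rule env_span_unit) (use assms in \<open>auto simp: prefixed_words_0\<close>)
  then show ?case
    using gen_mult_env_span_words 0[of 0] by simp
next
  case (Suc i)
  let ?r = "pm_unit (replicate i t @ w) :: 'v list \<Rightarrow>\<^sub>0 'k"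
  have 1: "gen t * (gen y * ?r) \<in> env_span (prefixed_words t B (Suc i) (Suc M))"
    by (rule gen_mult_env_span, rule Suc.IH) (use Suc.prems in auto)
  \<comment> \<open>The iterated brackets of \<open>bracket y t\<close> up to order \<open>i\<close>
    are those of \<open>y\<close> from order 1 to \<open>Suc i\<close>, so the induction hypothesis
    applies to it.\<close>
  have "((\<lambda>x. bracket x t) ^^ j) (bracket y t) \<in> span B" if "j \<le> i" for j
    using Suc.prems[of "Suc j"] that by (simp add: funpow_Suc_right del: funpow.simps)
  then have 2: "gen (bracket y t) * ?r \<in> env_span (prefixed_words t B (Suc i) (Suc M))"
    using Suc.IH env_span_mono[OF prefixed_words_mono[of i "Suc i" "Suc M" "Suc M" t B]] by auto
  have 3: "(gen y * gen t - gen t * gen y - gen (bracket y t)) * ?r \<in> env_span (prefixed_words t B (Suc i) (Suc M))"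
    by (intro env_span_ideal env_ideal_mult_right gen_bracket)
  have "gen y * pm_unit (replicate (Suc i) t @ w) =
      (gen y * gen t - gen t * gen y - gen (bracket y t)) * ?r + gen t * (gen y * ?r) + gen (bracket y t) * ?r"
    by (simp add: pm_unit_Cons algebra_simps)
  also have "\<dots> \<in> env_span (prefixed_words t B (Suc i) (Suc M))"
    by (intro env_span_closed(2) 1 2 3)
  finally show ?case .
qed

text \<open>Each exchange of \<open>b\<close> with its neighbour \<open>c\<close> costs a term in
  which \<open>bracket b c\<close>, a combination of elements of \<open>B\<close>, replaces the two
  letters. The words compared have up to \<open>M + 1\<close> letters, the error terms at most
  \<open>M\<close>.\<close>

lemma move_to_front:
  assumes "\<And>b c. b \<in> B \<Longrightarrow> c \<in> B \<Longrightarrow> bracket b c \<in> span B"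
    and "b \<in> B" "set v \<subseteq> B" "set v' \<subseteq> B" "length v + length v' \<le> M"
  shows "pm_unit (b # v @ v') - pm_unit (v @ b # v') \<in> env_span (prefixed_words t B 0 M)"
  using assms(3,5)
proof (induction v arbitrary: M)
  case Nil
  then show ?case
    by (simp add: env_span_closed)
next
  case (Cons c v)
  then obtain M' where M: "M = Suc M'" "length v + length v' \<le> M'"
    by (cases M) auto
  have bc: "bracket b c \<in> span B"
    using assms(1,2) Cons.prems by auto
  let ?r = "pm_unit (v @ v') :: 'v list \<Rightarrow>\<^sub>0 'k"
  have "?r \<in> env_span (prefixed_words t B 0 M')"
    using Cons.prems M assms(4) by (intro env_span_unit) (auto simp: prefixed_words_0)
  then have 1: "gen (bracket b c) * ?r \<in> env_span (prefixed_words t B 0 M)"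
    unfolding M(1) by (rule gen_mult_env_span_words[OF bc])
  have 2: "gen c * (pm_unit (b # v @ v') - pm_unit (v @ b # v')) \<in> env_span (prefixed_words t B 0 M)"
    unfolding M(1) using Cons M by (intro gen_mult_env_span_words) (auto intro: span_base)
  have 3: "(gen b * gen c - gen c * gen b - gen (bracket b c)) * ?r \<in> env_span (prefixed_words t B 0 M)"
    by (intro env_span_ideal env_ideal_mult_right gen_bracket)
  have "pm_unit (b # (c # v) @ v') - pm_unit ((c # v) @ b # v') =
      (gen b * gen c - gen c * gen b - gen (bracket b c)) * ?r +
      gen c * (pm_unit (b # v @ v') - pm_unit (v @ b # v')) + gen (bracket b c) * ?r"
    by (simp add: pm_unit_Cons algebra_simps)
  also have "\<dots> \<in> env_span (prefixed_words t B 0 M)"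
    by (intro env_span_closed(2) 1 2 3)
  finally show ?case .
qed

text \<open>The first letter of \<open>u\<close> is moved to the front of \<open>v\<close>, and the
  remaining words are compared by induction. Up to shorter words, letters from \<open>B\<close> thus
  commute.\<close>

lemma permuted_words:
  assumes "\<And>b c. b \<in> B \<Longrightarrow> c \<in> B \<Longrightarrow> bracket b c \<in> span B"
    and "mset u = mset v" "set u \<subseteq> B" "length u \<le> Suc M"
  shows "pm_unit u - pm_unit v \<in> env_span (prefixed_words t B 0 M)"
  using assms(2-4)
proof (induction u arbitrary: v M)
  case Nil
  then show ?case
    by (simp add: env_span_closed)
next
  case (Cons b u)
  have "b \<in> set v"
    using Cons.prems(1) by (metis list.set_intros(1) set_mset_mset)
  then obtain v1 v2 where v: "v = v1 @ b # v2"
    by (meson split_list)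
  have ms: "mset u = mset (v1 @ v2)"
    using Cons.prems(1) v by simp
  then have len: "length u = length v1 + length v2" and set: "set u = set v1 \<union> set v2"
    by (metis size_mset length_append) (metis ms set_append set_mset_mset)
  have 1: "pm_unit (b # v1 @ v2) - pm_unit (v1 @ b # v2) \<in> env_span (prefixed_words t B 0 M)"
    using Cons.prems len set by (intro move_to_front assms(1)) auto
  \<comment> \<open>For \<open>M = 0\<close> the remaining words are empty and the difference is 0.
    Otherwise the induction hypothesis at \<open>M - 1\<close> leaves room for the letter
    \<open>b\<close>.\<close>
  have 2: "gen b * (pm_unit u - pm_unit (v1 @ v2)) \<in> env_span (prefixed_words t B 0 M)"
  proof (cases M)
    case 0
    then show ?thesis
      using Cons.prems len by (simp add: env_span_closed)
  next
    case (Suc M')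
    then show ?thesis
      using Cons.prems Cons.IH[OF ms] by (auto intro!: gen_mult_env_span_words span_base)
  qed
  have "pm_unit (b # u) - pm_unit v =
      gen b * (pm_unit u - pm_unit (v1 @ v2)) + (pm_unit (b # v1 @ v2) - pm_unit (v1 @ b # v2))"
    by (simp add: v pm_unit_Cons algebra_simps)
  also have "\<dots> \<in> env_span (prefixed_words t B 0 M)"
    by (intro env_span_closed(2) 1 2)
  finally show ?case .
qed

text \<open>One arbitrary arrangement is chosen for each multiset. These words play the role of the
  ordered monomials of the Poincare-Birkhoff-Witt theorem, without fixing an order on
  \<open>B\<close>.\<close>

definition multiset_words :: "'v set \<Rightarrow> nat \<Rightarrow> 'v list set" where
  "multiset_words B M = (\<lambda>\<mu>. SOME w. mset w = \<mu>) ` {\<mu>. set_mset \<mu> \<subseteq> B \<and> size \<mu> \<le> M}"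

text \<open>By induction on \<open>M\<close>: a word differs from the chosen arrangement of its
  letters by shorter words. This is the spanning half of the Poincare-Birkhoff-Witt theorem.\<close>

lemma env_span_multiset_words:
  assumes "\<And>b c. b \<in> B \<Longrightarrow> c \<in> B \<Longrightarrow> bracket b c \<in> span B"
  shows "env_span (prefixed_words t B 0 M) \<subseteq> env_span (multiset_words B M)"
proof (induction M)
  case 0
  show ?case
    by (rule env_span_mono) (auto simp: prefixed_words_0 multiset_words_def image_iff intro!: exI[of _ "{#}"])
next
  case (Suc M)
  have mono: "env_span (multiset_words B M) \<subseteq> env_span (multiset_words B (Suc M))"
    by (rule env_span_mono) (auto simp: multiset_words_def)
  show ?case
  proof (rule env_span_minimal)
    fix w assume w: "w \<in> prefixed_words t B 0 (Suc M)"
    define v where "v = (SOME v. mset v = mset w)"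
    have "mset w = mset v"
      unfolding v_def by (rule someI2[of _ w]) auto
    then have "pm_unit w - pm_unit v \<in> env_span (prefixed_words t B 0 M)"
      using w by (intro permuted_words assms) (auto simp: prefixed_words_0)
    then have 1: "pm_unit w - pm_unit v \<in> env_span (multiset_words B (Suc M))"
      using Suc mono by blast
    have "pm_unit v \<in> env_span (multiset_words B (Suc M))"
      using w unfolding v_def multiset_words_def by (intro env_span_unit imageI) (auto simp: prefixed_words_0)
    from env_span_closed(2)[OF 1 this] show "pm_unit w \<in> env_span (multiset_words B (Suc M))"
      by simp
  qed
qed

section \<open>Dimension estimates and almost invariant subcoalgebras\<close>

lemma linear_funpow:
  assumes "Vector_Spaces.linear scale scale g"
  shows "Vector_Spaces.linear scale scale (g ^^ n)"
proof (induction n)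
  case 0
  show ?case
    by (simp add: Vector_Spaces.linear_iff vector_space_axioms)
next
  case (Suc n)
  then show ?case
    using assms by (simp add: Vector_Spaces.linear_iff)
qed

text \<open>Modulo the ideal, the span for \<open>N\<close> is the sum of the products of the powers
  of \<open>t\<close> up to \<open>N\<close> with the span for \<open>0\<close>. Dimensions are
  taken under \<open>\<rho>\<close>, whose image is a copy of the enveloping algebra.\<close>

lemma dim_prefixed_words_le:
  fixes \<rho> :: "('v list \<Rightarrow>\<^sub>0 'k) \<Rightarrow> ('v list \<Rightarrow>\<^sub>0 'k)"
  assumes lin: "Vector_Spaces.linear pm_scale pm_scale \<rho>"
    and proj: "\<And>p. p - \<rho> p \<in> env_ideal" and ker: "\<And>p. p \<in> env_ideal \<Longrightarrow> \<rho> p = 0"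
    and fin: "finite B"
  shows "pm.dim (\<rho> ` env_span (prefixed_words t B N M)) \<le> Suc N * pm.dim (\<rho> ` env_span (prefixed_words t B 0 M))"
proof -
  interpret \<rho>: Vector_Spaces.linear pm_scale pm_scale \<rho>
    by (rule lin)
  let ?A = "\<lambda>N. env_span (prefixed_words t B N M)"
  have \<rho>_eq: "\<rho> p = \<rho> q" if "p - q \<in> env_ideal" for p q
    using ker[OF that] by (simp add: \<rho>.diff)
  obtain G where G: "G \<subseteq> \<rho> ` ?A 0" "pm.independent G" "\<rho> ` ?A 0 \<subseteq> pm.span G"
    "card G = pm.dim (\<rho> ` ?A 0)"
    by (rule pm.basis_exists)
  have "\<rho> ` ?A 0 \<subseteq> pm.span (\<rho> ` pm_unit ` prefixed_words t B 0 M)"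
  proof -
    have "\<rho> ` ?A 0 = pm.span (\<rho> ` (pm_unit ` prefixed_words t B 0 M \<union> env_ideal))"
      unfolding env_span_def by (rule \<rho>.span_image[symmetric])
    also have "\<dots> \<subseteq> pm.span (\<rho> ` pm_unit ` prefixed_words t B 0 M)"
      by (rule pm.span_minimal) (auto simp: ker pm.span_zero intro: pm.span_base)
    finally show ?thesis .
  qed
  with G(1) have "G \<subseteq> pm.span (\<rho> ` pm_unit ` prefixed_words t B 0 M)"
    by (rule subset_trans)
  then have "finite G"
    using pm.independent_span_bound[OF _ G(2)] finite_prefixed_words[OF fin] by (metis finite_imageI)
  \<comment> \<open>The spanning set for \<open>N\<close>: the basis \<open>G\<close> of the case
    \<open>0\<close>, multiplied by the powers of \<open>t\<close> and projected back.\<close>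
  let ?H = "(\<lambda>(i, g). \<rho> (pm_unit (replicate i t) * g)) ` ({..N} \<times> G)"
  have word: "\<rho> (pm_unit w) \<in> pm.span ?H" if "w \<in> prefixed_words t B N M" for w
  proof -
    obtain i v where v: "w = replicate i t @ v" "i \<le> N" "length v \<le> M" "set v \<subseteq> B"
      using \<open>w \<in> prefixed_words t B N M\<close> by (auto simp: prefixed_words_def)
    have "pm_unit v \<in> ?A 0"
      using v by (intro env_span_unit) (simp add: prefixed_words_0)
    then have "\<rho> (pm_unit v) \<in> pm.span G"
      using G(3) by blast
    then have "\<rho> (pm_unit (replicate i t) * \<rho> (pm_unit v)) \<in> pm.span ?H"
    proof (induction rule: pm.span_induct_alt)
      case base
      show ?case
        by (simp add: \<rho>.zero pm.span_zero)
    next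
      case (step c x y)
      have "\<rho> (pm_unit (replicate i t) * x) \<in> pm.span ?H"
        using step(1) v(2) by (intro pm.span_base image_eqI[of _ _ "(i, x)"]) auto
      then show ?case
        using step(2) by (simp add: distrib_left pm_scale_mult_right \<rho>.add \<rho>.scale pm.span_add pm.span_scale)
    qed
    \<comment> \<open>Applying \<open>\<rho>\<close> to the right factor changes the product only by
      an element of the ideal.\<close>
    moreover have "\<rho> (pm_unit w) = \<rho> (pm_unit (replicate i t) * \<rho> (pm_unit v))"
      unfolding v(1) pm_unit_append
      by (rule \<rho>_eq) (simp only: right_diff_distrib[symmetric] env_ideal_mult_left proj)
    ultimately show ?thesis
      by simp
  qed
  have "\<rho> ` ?A N = pm.span (\<rho> ` (pm_unit ` prefixed_words t B N M \<union> env_ideal))"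
    unfolding env_span_def by (rule \<rho>.span_image[symmetric])
  also have "\<dots> \<subseteq> pm.span ?H"
    by (rule pm.span_minimal) (auto simp: ker pm.span_zero intro: word)
  finally have "pm.dim (\<rho> ` ?A N) \<le> card ?H"
    using \<open>finite G\<close> by (intro pm.dim_le_card) auto
  also have "\<dots> \<le> card ({..N} \<times> G)"
    using \<open>finite G\<close> by (intro card_image_le) auto
  also have "\<dots> = Suc N * card G"
    by (simp add: card_cartesian_product)
  finally show ?thesis
    by (simp only: G(4))
qed

text \<open>By \<open>env_span_multiset_words\<close> one word for each multiset of at most
  \<open>M\<close> elements of \<open>B\<close> suffices, and the number of these multisets is
  polynomial in \<open>M\<close>.\<close>

lemma dim_words_polynomial:
  fixes \<rho> :: "('v list \<Rightarrow>\<^sub>0 'k) \<Rightarrow> ('v list \<Rightarrow>\<^sub>0 'k)"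
  assumes lin: "Vector_Spaces.linear pm_scale pm_scale \<rho>"
    and ker: "\<And>p. p \<in> env_ideal \<Longrightarrow> \<rho> p = 0"
    and fin: "finite B" and br: "\<And>b c. b \<in> B \<Longrightarrow> c \<in> B \<Longrightarrow> bracket b c \<in> span B"
  shows "pm.dim (\<rho> ` env_span (prefixed_words t B 0 M)) \<le> (M + 1) ^ card B"
proof -
  interpret \<rho>: Vector_Spaces.linear pm_scale pm_scale \<rho>
    by (rule lin)
  have "\<rho> ` env_span (prefixed_words t B 0 M) \<subseteq> \<rho> ` env_span (multiset_words B M)"
    using env_span_multiset_words br by blast
  also have "\<dots> = pm.span (\<rho> ` (pm_unit ` multiset_words B M \<union> env_ideal))"
    unfolding env_span_def by (rule \<rho>.span_image[symmetric])
  also have "\<dots> \<subseteq> pm.span (\<rho> ` pm_unit ` multiset_words B M)"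
    by (rule pm.span_minimal) (auto simp: ker pm.span_zero intro: pm.span_base)
  finally have "pm.dim (\<rho> ` env_span (prefixed_words t B 0 M)) \<le> card (\<rho> ` pm_unit ` multiset_words B M)"
    using card_multisets_size_le(1)[OF fin] by (intro pm.dim_le_card) (auto simp: multiset_words_def)
  also have "\<dots> = card ((\<lambda>\<mu>. \<rho> (pm_unit (SOME w. mset w = \<mu>))) ` {\<mu>. set_mset \<mu> \<subseteq> B \<and> size \<mu> \<le> M})"
    by (simp add: multiset_words_def image_image)
  also have "\<dots> \<le> card {\<mu>. set_mset \<mu> \<subseteq> B \<and> size \<mu> \<le> M}"
    by (rule card_image_le[OF card_multisets_size_le(1)[OF fin]])
  also have "\<dots> \<le> (M + 1) ^ card B"
    by (rule card_multisets_size_le(2)[OF fin])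
  finally show ?thesis .
qed

text \<open>If every diagonal step multiplied the dimension by \<open>1 + \<epsilon>\<close>, then \<open>n\<close> steps from \<open>(0, M)\<close> would
  multiply it by more than \<open>2 (n + 1)\<close>. As the dimension at \<open>(n, M + n)\<close> is at most \<open>n + 1\<close> times that
  at \<open>(0, M + n)\<close>, the dimension at \<open>(0, M)\<close> would double whenever \<open>M\<close> grows by \<open>n\<close>, although it is
  polynomial in \<open>M\<close>.\<close>

lemma exists_almost_invariant_step:
  fixes \<rho> :: "('v list \<Rightarrow>\<^sub>0 'k) \<Rightarrow> ('v list \<Rightarrow>\<^sub>0 'k)" and \<epsilon> :: real
  assumes lin: "Vector_Spaces.linear pm_scale pm_scale \<rho>"
    and proj: "\<And>p. p - \<rho> p \<in> env_ideal" and ker: "\<And>p. p \<in> env_ideal \<Longrightarrow> \<rho> p = 0"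
    and fin: "finite B" and br: "\<And>b c. b \<in> B \<Longrightarrow> c \<in> B \<Longrightarrow> bracket b c \<in> span B"
    and n: "2 * (real n + 1) < (1 + \<epsilon>) ^ n" and \<epsilon>: "0 < \<epsilon>"
  shows "\<exists>N<n. \<exists>M. real (pm.dim (\<rho> ` env_span (prefixed_words t B (Suc N) (Suc M)))) <
    (1 + \<epsilon>) * real (pm.dim (\<rho> ` env_span (prefixed_words t B N M)))"
proof (rule ccontr)
  define d where "d N M = pm.dim (\<rho> ` env_span (prefixed_words t B N M))" for N M
  assume "\<not> ?thesis"
  then have step: "(1 + \<epsilon>) * real (d N M) \<le> real (d (Suc N) (Suc M))" if "N < n" for N M
    using that unfolding d_def by (meson not_less)
  have pow: "(1 + \<epsilon>) ^ k * real (d 0 M) \<le> real (d k (M + k))" if "k \<le> n" for k M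
    using that
  proof (induction k)
    case (Suc k)
    have "(1 + \<epsilon>) ^ Suc k * real (d 0 M) \<le> (1 + \<epsilon>) * real (d k (M + k))"
      using Suc \<epsilon> by (simp add: mult.assoc)
    also have "\<dots> \<le> real (d (Suc k) (M + Suc k))"
      using step[of k "M + k"] Suc.prems by simp
    finally show ?case .
  qed simp
  \<comment> \<open>The empty word contributes the class of 1: dimension 0 would force
    \<open>\<rho> 1 = 0\<close> and thus put 1 into the ideal.\<close>
  have "0 < d 0 0"
  proof (rule ccontr)
    assume "\<not> 0 < d 0 0"
    obtain G where G: "G \<subseteq> \<rho> ` env_span (prefixed_words t B 0 0)" "pm.independent G"
      "\<rho> ` env_span (prefixed_words t B 0 0) \<subseteq> pm.span G" "card G = d 0 0"
      unfolding d_def by (rule pm.basis_exists)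
    have "pm_unit [] \<in> env_span (prefixed_words t B 0 0)"
      by (rule env_span_unit) (simp add: prefixed_words_0)
    then have "\<rho> 1 \<in> pm.span G"
      using G(3) by (auto simp: pm_unit_Nil)
    moreover have "finite G"
    proof -
      interpret \<rho>: Vector_Spaces.linear pm_scale pm_scale \<rho>
        by (rule lin)
      have "\<rho> ` env_span (prefixed_words t B 0 0) = pm.span (\<rho> ` (pm_unit ` prefixed_words t B 0 0 \<union> env_ideal))"
        unfolding env_span_def by (rule \<rho>.span_image[symmetric])
      also have "\<dots> \<subseteq> pm.span (\<rho> ` pm_unit ` prefixed_words t B 0 0)"
        by (rule pm.span_minimal) (auto simp: ker pm.span_zero intro: pm.span_base)
      finally have "G \<subseteq> pm.span (\<rho> ` pm_unit ` prefixed_words t B 0 0)"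
        by (rule subset_trans[OF G(1)])
      then show ?thesis
        using pm.independent_span_bound[OF _ G(2)] finite_prefixed_words[OF fin] by (metis finite_imageI)
    qed
    ultimately have "\<rho> 1 = 0"
      using G(4) \<open>\<not> 0 < d 0 0\<close> by auto
    then show False
      using proj[of 1] one_notin_env_ideal by simp
  qed
  moreover have "d 0 M \<le> (M + 1) ^ card B" for M
    unfolding d_def by (rule dim_words_polynomial[OF lin ker fin br])
  moreover have "0 < n"
    using n by (cases n) auto
  ultimately obtain M where M: "d 0 (M + n) < 2 * d 0 M"
    using not_doubling_if_polynomial[of "d 0"] by blast
  have "2 * (real n + 1) * real (d 0 M) \<le> (1 + \<epsilon>) ^ n * real (d 0 M)"
    using n by (intro mult_right_mono) auto
  also have "\<dots> \<le> real (d n (M + n))"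
    by (rule pow) simp
  also have "\<dots> \<le> real (Suc n * d 0 (M + n))"
    unfolding d_def by (intro of_nat_mono dim_prefixed_words_le lin proj ker fin)
  also have "\<dots> < real (Suc n * (2 * d 0 M))"
    using M by (intro of_nat_less_iff[THEN iffD2] mult_strict_left_mono) auto
  finally show False
    by (simp add: algebra_simps)
qed

text \<open>In the splitting of \<open>f\<close> into \<open>c *s t\<close> and a remainder, the
  first summand lengthens the prefix by one, while the remainder adds one letter from
  \<open>B\<close> behind it. Hence both parameters grow by one.\<close>

lemma gen_mult_env_span_subset:
  assumes "\<And>j. j \<le> n \<Longrightarrow> ((\<lambda>x. bracket x t) ^^ j) (f - c *s t) \<in> span B" "N \<le> n"
    and "w \<in> prefixed_words t B N M"
  shows "gen f * pm_unit w \<in> env_span (prefixed_words t B (Suc N) (Suc M))"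
proof -
  let ?A = "env_span (prefixed_words t B (Suc N) (Suc M))" and ?y = "f - c *s t"
  obtain i v where v: "w = replicate i t @ v" "i \<le> N" "length v \<le> M" "set v \<subseteq> B"
    using assms(3) by (auto simp: prefixed_words_def)
  have "gen ?y * pm_unit w \<in> env_span (prefixed_words t B i (Suc M))"
    unfolding v(1) by (rule gen_mult_prefixed_word) (use assms v in auto)
  also have "\<dots> \<subseteq> ?A"
    using v by (intro env_span_mono prefixed_words_mono) auto
  finally have 1: "gen ?y * pm_unit w \<in> ?A" .
  have "gen t * pm_unit w \<in> ?A"
    unfolding pm_unit_Cons[symmetric]
    using env_span_unit[OF prefixed_words_Cons[OF assms(3)]]
      env_span_mono[OF prefixed_words_mono[of "Suc N" "Suc N" M "Suc M" t B]] by auto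
  then have 2: "pm_scale c (gen t * pm_unit w) \<in> ?A"
    by (rule env_span_closed(4))
  have 3: "((gen (c *s t + ?y) - gen (c *s t) - gen ?y) + (gen (c *s t) - pm_scale c (gen t))) * pm_unit w \<in> ?A"
    by (intro env_span_ideal env_ideal_mult_right env_ideal_closed(2) gen_add gen_scale)
  have "gen f * pm_unit w = ((gen (c *s t + ?y) - gen (c *s t) - gen ?y) + (gen (c *s t) - pm_scale c (gen t))) * pm_unit w
      + pm_scale c (gen t * pm_unit w) + gen ?y * pm_unit w"
    by (simp add: algebra_simps pm_scale_mult_left)
  also have "\<dots> \<in> ?A"
    by (intro env_span_closed(2) 1 2 3)
  finally show ?thesis .
qed

text \<open>The kernel of \<open>\<pi>\<close> is an ideal of codimension 1 complemented by
  \<open>t\<close>. The space \<open>E'\<close>, which represents \<open>E + F E\<close>, lies in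
  the span for the next pair of parameters, so a pair from
  \<open>exists_almost_invariant_step\<close> makes \<open>E\<close> almost invariant.\<close>

theorem amenable_if_codim_1_locally_finite_dimensional:
  assumes lin: "\<And>x y. \<pi> (x + y) = \<pi> x + \<pi> y" "\<And>c x. \<pi> (c *s x) = c * \<pi> x"
    and t: "\<pi> t = 1"
    and lfd: "\<And>X. finite X \<Longrightarrow> \<pi> ` X \<subseteq> {0} \<Longrightarrow> \<exists>S. lie_subalgebra S \<and> finite_dim S \<and> X \<subseteq> S"
    and br: "\<And>x y. \<pi> (bracket x y) = 0"
  shows amenable
  unfolding amenable_def
proof (intro allI impI)
  fix F and \<epsilon> :: real
  assume F: "subspace F" "finite_dim F" "0 < \<epsilon>"
  \<comment> \<open>\<open>n\<close> is fixed before \<open>B\<close>: it bounds the prefix lengths,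
    hence the order of the brackets with \<open>t\<close> that \<open>B\<close> has to
    absorb.\<close>
  obtain n where n: "2 * (real n + 1) < (1 + \<epsilon>) ^ n"
    using linear_less_power[OF F(3)] by blast
  obtain \<rho> where \<rho>: "Vector_Spaces.linear pm_scale pm_scale \<rho>"
    "\<And>p. p - \<rho> p \<in> env_ideal" "\<And>p. p \<in> env_ideal \<Longrightarrow> \<rho> p = 0"
    using env_ideal_projection by blast
  obtain FB where FB: "finite FB" "F \<subseteq> span FB"
    using F(2) by (auto simp: finite_dim_def)
  define ad where "ad = (\<lambda>x. bracket x t)"
  \<comment> \<open>The components of the elements of \<open>FB\<close> in the kernel of
    \<open>\<pi>\<close>, with their brackets with \<open>t\<close> up to order \<open>n\<close>.
    All of them lie in the kernel, so one finite-dimensional subalgebra contains them.\<close>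
  define X where "X = (\<lambda>(j, f). (ad ^^ j) (f - \<pi> f *s t)) ` ({..n} \<times> FB)"
  have \<pi>0: "\<pi> (f - \<pi> f *s t) = 0" for f
    using lin(1)[of "f - \<pi> f *s t" "\<pi> f *s t"] lin(2)[of "\<pi> f" t] t by simp
  have "\<pi> ((ad ^^ j) (f - \<pi> f *s t)) = 0" for j f
    by (cases j) (simp_all add: \<pi>0 ad_def br)
  then have "finite X" "\<pi> ` X \<subseteq> {0}"
    using FB(1) by (auto simp: X_def)
  then obtain S where S: "lie_subalgebra S" "finite_dim S" "X \<subseteq> S"
    using lfd by blast
  obtain B where B: "B \<subseteq> S" "independent B" "S \<subseteq> span B"
    using basis_exists[of S] by metis
  have finB: "finite B"
    using S(2) B independent_span_bound[of _ B] unfolding finite_dim_def by blast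
  have "subspace S"
    using S(1) by (simp add: lie_subalgebra_def)
  then have spanB: "span B = S"
    using B span_minimal by blast
  have brB: "bracket b c \<in> span B" if "b \<in> B" "c \<in> B" for b c
    using that B(1) S(1) unfolding spanB lie_subalgebra_def by blast
  have ad: "(ad ^^ j) (f - \<pi> f *s t) \<in> span B" if "j \<le> n" "f \<in> F" for j f
  proof -
    interpret ad: Vector_Spaces.linear scale scale "ad ^^ j"
      by (rule linear_funpow)
        (simp add: ad_def Vector_Spaces.linear_iff vector_space_axioms bracket_add_left bracket_scale_left)
    have "f \<in> span FB"
      using that FB by blast
    then show ?thesis
    proof (induction rule: span_induct_alt)
      case base
      have "\<pi> 0 = 0"
        using lin(2)[of 0 0] by simp
      then show ?case
        by (simp add: span_zero ad.zero)
    next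
      case (step c x y)
      have x: "(ad ^^ j) (x - \<pi> x *s t) \<in> span B"
        using step(1) that(1) S(3) unfolding spanB X_def by force
      have eq: "(c *s x + y) - \<pi> (c *s x + y) *s t = c *s (x - \<pi> x *s t) + (y - \<pi> y *s t)"
        by (simp add: lin scale_left_distrib scale_right_diff_distrib algebra_simps)
      show ?case
        unfolding eq ad.add ad.scale by (intro span_add span_scale x step(2))
    qed
  qed
  obtain N M where NM: "N < n" "real (pm.dim (\<rho> ` env_span (prefixed_words t B (Suc N) (Suc M)))) <
      (1 + \<epsilon>) * real (pm.dim (\<rho> ` env_span (prefixed_words t B N M)))"
    using exists_almost_invariant_step[OF \<rho> finB brB n F(3)] by blast
  interpret \<rho>: Vector_Spaces.linear pm_scale pm_scale \<rho>
    by (rule \<rho>(1))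
  define E where "E = pm.span (pm_unit ` prefixed_words t B N M :: ('v list \<Rightarrow>\<^sub>0 'k) set)"
  define FE where "FE = pm.span {gen f * e | f e. f \<in> F \<and> e \<in> E}"
  define E' where "E' = {a + b | a b. a \<in> E \<and> b \<in> FE}"
  have \<rho>_span: "\<rho> ` env_span W = \<rho> ` pm.span (pm_unit ` W)" for W
  proof
    have "\<rho> ` env_span W = pm.span (\<rho> ` (pm_unit ` W \<union> env_ideal))"
      unfolding env_span_def by (rule \<rho>.span_image[symmetric])
    also have "\<dots> \<subseteq> pm.span (\<rho> ` pm_unit ` W)"
      by (rule pm.span_minimal) (auto simp: \<rho>(3) pm.span_zero intro: pm.span_base)
    finally show "\<rho> ` env_span W \<subseteq> \<rho> ` pm.span (pm_unit ` W)"
      by (simp add: \<rho>.span_image)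
  qed (use span_subset_env_span in blast)
  have class_\<rho>: "env_class ` \<rho> ` A = env_class ` A" for A
  proof -
    have "env_class (\<rho> p) = env_class p" for p
      using env_class_eqI[OF \<rho>(2)[of p]] by simp
    then show ?thesis
      by (simp add: image_image)
  qed
  \<comment> \<open>The image of \<open>\<rho>\<close> meets the ideal only in 0, so passing from
    projected elements to classes preserves dimensions.\<close>
  have inj: "inj_on env_class (\<rho> ` A)" for A
  proof (rule inj_onI, clarify)
    fix p q assume "env_class (\<rho> p) = env_class (\<rho> q)"
    then have *: "\<rho> p - \<rho> q \<in> env_ideal"
      by (rule env_class_eqD)
    have "(p - \<rho> p) + (\<rho> p - \<rho> q) - (q - \<rho> q) \<in> env_ideal"
      by (rule env_ideal_closed(3)[OF env_ideal_closed(2)[OF \<rho>(2) *] \<rho>(2)])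
    then have "\<rho> (p - q) = 0"
      by (intro \<rho>(3)) simp
    then show "\<rho> p = \<rho> q"
      by (simp add: \<rho>.diff)
  qed
  have sub: "pm.subspace E" "pm.subspace E'" "E \<subseteq> E'"
  proof -
    show "pm.subspace E" "pm.subspace E'"
      unfolding E'_def by (auto simp: E_def FE_def intro!: pm.subspace_sums)
    show "E \<subseteq> E'"
      unfolding E'_def FE_def using pm.span_zero by force
  qed
  have "FE \<subseteq> env_span (prefixed_words t B (Suc N) (Suc M))"
    unfolding FE_def
  proof (rule pm.span_minimal[OF _ subspace_env_span], safe)
    fix f e assume f: "f \<in> F" and "e \<in> E"
    then have "e \<in> env_span (prefixed_words t B N M)"
      using span_subset_env_span unfolding E_def by blast
    then show "gen f * e \<in> env_span (prefixed_words t B (Suc N) (Suc M))"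
      by (rule env_span_mult_left[rotated]) (rule gen_mult_env_span_subset[where n = n],
        use ad[unfolded ad_def] f NM(1) in auto)
  qed
  moreover have "E \<subseteq> env_span (prefixed_words t B (Suc N) (Suc M))"
    using span_subset_env_span env_span_mono[OF prefixed_words_mono[of N "Suc N" M "Suc M" t B]]
    unfolding E_def by fastforce
  ultimately have "E' \<subseteq> env_span (prefixed_words t B (Suc N) (Suc M))"
    unfolding E'_def using env_span_closed(2) by blast
  then have "\<rho> ` E' \<subseteq> \<rho> ` env_span (prefixed_words t B (Suc N) (Suc M))"
    by blast
  also have big: "\<dots> = pm.span (\<rho> ` pm_unit ` prefixed_words t B (Suc N) (Suc M))"
    by (simp add: \<rho>_span \<rho>.span_image)
  finally have fin': "\<rho> ` E' \<subseteq> pm.span (\<rho> ` pm_unit ` prefixed_words t B (Suc N) (Suc M))"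
    "finite (\<rho> ` pm_unit ` prefixed_words t B (Suc N) (Suc M))"
    using finite_prefixed_words[OF finB] by auto
  have dimE': "pm.dim (\<rho> ` E') \<le> pm.dim (\<rho> ` env_span (prefixed_words t B (Suc N) (Suc M)))"
    by (rule pm.dim_mono_finite[OF _ _ fin'(2)]) (use fin'(1) big pm.span_superset in auto)
  have dimE: "pm.dim (\<rho> ` E) = pm.dim (\<rho> ` env_span (prefixed_words t B N M))"
    by (simp add: \<rho>_span E_def)
  have sub\<rho>: "pm.subspace (\<rho> ` E)" "pm.subspace (\<rho> ` E')" "\<rho> ` E \<subseteq> \<rho> ` E'"
    using sub \<rho>.subspace_image by auto
  interpret E: onto_module pm_scale "\<rho> ` E" env_class "env_algebra\<lparr>carrier := env_class ` E\<rparr>"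
    using env.onto_module_subspace[OF sub\<rho>(1)] by (simp add: class_\<rho>)
  interpret E': onto_module pm_scale "\<rho> ` E'" env_class "env_algebra\<lparr>carrier := env_class ` E'\<rparr>"
    using env.onto_module_subspace[OF sub\<rho>(2)] by (simp add: class_\<rho>)
  have E_dim: "E.V.fin_dim" "E.V.dim = pm.dim (\<rho> ` E)"
    using E.dim_eq[OF inj fin'(2)] fin'(1) sub\<rho>(3) by auto
  have le: "vectorspace.dim class_ring (quotient_module (env_algebra\<lparr>carrier := env_class ` E'\<rparr>) (env_class ` E))
      \<le> pm.dim (\<rho> ` E') - pm.dim (\<rho> ` E)"
    using E'.dim_quotient_le[OF fin'(2,1) sub\<rho>(1,3)] by (simp add: class_\<rho>)
  have lt: "real (pm.dim (\<rho> ` E') - pm.dim (\<rho> ` E)) < \<epsilon> * real (pm.dim (\<rho> ` E))"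
  proof -
    have "pm.dim (\<rho> ` E) \<le> pm.dim (\<rho> ` E')"
      by (rule pm.dim_mono_finite[OF subset_trans[OF sub\<rho>(3) pm.span_superset] fin'(1,2)])
    then show ?thesis
      using NM(2) dimE' by (simp add: of_nat_diff dimE algebra_simps)
  qed
  have *: "real (vectorspace.dim class_ring (quotient_module (env_algebra\<lparr>carrier := env_class ` E'\<rparr>) (env_class ` E)))
      < \<epsilon> * real (vectorspace.dim class_ring (env_algebra\<lparr>carrier := env_class ` E\<rparr>))"
    unfolding E_dim(2) by (rule le_less_trans[OF of_nat_mono[OF le] lt])
  have E'_eq: "env_class ` E <+>\<^bsub>env_algebra\<^esub> env_act F (env_class ` E) = env_class ` E'"
    by (simp add: env_act_image env_set_add_image E'_def FE_def)
  show "\<exists>E. subcoalgebra E \<and> vectorspace.fin_dim class_ring (env_algebra\<lparr>carrier := E\<rparr>) \<and>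
      real (vectorspace.dim class_ring
        (quotient_module (env_algebra\<lparr>carrier := E <+>\<^bsub>env_algebra\<^esub> env_act F E\<rparr>) E))
      < \<epsilon> * real (vectorspace.dim class_ring (env_algebra\<lparr>carrier := E\<rparr>))"
  proof (intro exI[of _ "env_class ` E"] conjI)
    show "subcoalgebra (env_class ` E)"
      unfolding E_def by (rule subcoalgebra_span_words) (rule subseqs_prefixed_words)
    show "vectorspace.fin_dim class_ring (env_algebra\<lparr>carrier := env_class ` E\<rparr>)"
      by (rule E_dim(1))
    show "real (vectorspace.dim class_ring
        (quotient_module (env_algebra\<lparr>carrier := env_class ` E <+>\<^bsub>env_algebra\<^esub> env_act F (env_class ` E)\<rparr>)
          (env_class ` E)))
      < \<epsilon> * real (vectorspace.dim class_ring (env_algebra\<lparr>carrier := env_class ` E\<rparr>))"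
      unfolding E'_eq by (rule *)
  qed
qed

end

section \<open>Transporting Lie algebras along injective linear maps\<close>

lemma pm_unit_eq_iff: "pm_unit a = (pm_unit b :: 'a \<Rightarrow>\<^sub>0 'k::field) \<longleftrightarrow> a = b"
  by (metis lookup_single_eq lookup_single_not_eq zero_neq_one)

lemma independent_pm_unit: "pm.independent (pm_unit ` A :: ('a \<Rightarrow>\<^sub>0 'k::field) set)"
  unfolding pm.independent_explicit_module
proof (intro allI impI)
  fix T u and v :: "'a \<Rightarrow>\<^sub>0 'k"
  assume T: "finite T" "T \<subseteq> pm_unit ` A" "(\<Sum>v\<in>T. pm_scale (u v) v) = 0" "v \<in> T"
  then obtain a where a: "v = pm_unit a"
    by blast
  have "Poly_Mapping.lookup (pm_scale (u w) w) a = (if w = v then u w else 0)" if w: "w \<in> T" for w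
  proof -
    obtain b where "w = pm_unit b"
      using w T(2) by blast
    then show ?thesis
      by (simp add: a lookup_single when_def pm_unit_eq_iff)
  qed
  then have "Poly_Mapping.lookup (\<Sum>w\<in>T. pm_scale (u w) w) a = (\<Sum>w\<in>T. if w = v then u w else 0)"
    unfolding lookup_sum by (intro sum.cong) auto
  then show "u v = 0"
    using T by (simp add: sum.delta)
qed

text \<open>Each element is supported on an initial segment of the enumeration
  \<open>to_nat\<close>. The span of such a segment is finite-dimensional and meets \<open>B\<close>
  in a finite set, so \<open>B\<close> is a countable union of finite sets.\<close>

lemma countable_pm_independent:
  fixes B :: "('a::countable \<Rightarrow>\<^sub>0 'k::field) set"
  assumes "pm.independent B"
  shows "countable B"
proof -
  let ?A = "\<lambda>n. {a :: 'a. to_nat a \<le> n}"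
  have "finite (B \<inter> pm.span (pm_unit ` ?A n))" for n
  proof -
    have "finite (to_nat -` {..n} :: 'a set)"
      by (rule finite_vimageI) auto
    then have "finite (?A n)"
      by (simp add: vimage_def)
    then show ?thesis
      using pm.independent_span_bound[of "pm_unit ` ?A n" "B \<inter> pm.span (pm_unit ` ?A n)"]
        pm.independent_mono[OF assms] by auto
  qed
  then have "countable (\<Union>n. B \<inter> pm.span (pm_unit ` ?A n))"
    by (intro countable_UN) (simp_all add: countable_finite)
  moreover have "b \<in> pm.span (pm_unit ` ?A (Max (to_nat ` Poly_Mapping.keys b)))" for b :: "'a \<Rightarrow>\<^sub>0 'k"
    by (rule in_span_pm_unit) auto
  then have "B \<subseteq> (\<Union>n. B \<inter> pm.span (pm_unit ` ?A n))"
    by blast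
  ultimately show ?thesis
    by (rule countable_subset[rotated])
qed

text \<open>A basis of \<open>U\<close> is countably infinite and can be enumerated by
  \<open>nat\<close>. This places the Lie algebras to be built on the whole type
  \<open>nat \<Rightarrow>\<^sub>0 'k\<close>.\<close>

lemma linear_parametrization:
  fixes U :: "('a::countable \<Rightarrow>\<^sub>0 'k::field) set"
  assumes U: "pm.subspace U" and inf: "\<And>G. finite G \<Longrightarrow> \<not> U \<subseteq> pm.span G"
  shows "\<exists>\<phi> :: (nat \<Rightarrow>\<^sub>0 'k) \<Rightarrow> ('a \<Rightarrow>\<^sub>0 'k).
    Vector_Spaces.linear pm_scale pm_scale \<phi> \<and> inj \<phi> \<and> range \<phi> = U"
proof -
  obtain B where B: "B \<subseteq> U" "pm.independent B" "U \<subseteq> pm.span B"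
    using pm.basis_exists[of U] by metis
  then have "infinite B"
    using inf by blast
  define e where "e = from_nat_into B"
  have e: "bij_betw e UNIV B"
    unfolding e_def by (rule bij_betw_from_nat_into[OF countable_pm_independent[OF B(2)] \<open>infinite B\<close>])
  define \<phi> where "\<phi> p = (\<Sum>k\<in>Poly_Mapping.keys p. pm_scale (Poly_Mapping.lookup p k) (e k))" for p
  have lin: "Vector_Spaces.linear pm_scale pm_scale \<phi>"
    unfolding \<phi>_def by (rule pm.linear_sum_keys)
  interpret \<phi>: Vector_Spaces.linear pm_scale pm_scale \<phi>
    by (rule lin)
  have "\<phi> (pm_unit k) = e k" for k
    by (simp add: \<phi>_def)
  then have "\<phi> ` range pm_unit = B"
    using e by (auto simp: bij_betw_def image_image)
  then have "range \<phi> = pm.span B"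
    using \<phi>.span_image[of "range pm_unit"] by (simp add: span_pm_unit)
  moreover have "pm.span B = U"
    using B U pm.span_minimal by blast
  moreover have "inj \<phi>"
    unfolding \<phi>.inj_iff_eq_0
  proof (intro allI impI)
    fix p assume "\<phi> p = 0"
    have inj: "inj e"
      using e by (simp add: bij_betw_def)
    have "(\<Sum>b\<in>e ` Poly_Mapping.keys p. pm_scale (Poly_Mapping.lookup p (inv_into UNIV e b)) b) = \<phi> p"
      unfolding \<phi>_def using inj by (subst sum.reindex) (auto intro: inj_on_subset)
    then have sum0: "(\<Sum>b\<in>e ` Poly_Mapping.keys p. pm_scale (Poly_Mapping.lookup p (inv_into UNIV e b)) b) = 0"
      using \<open>\<phi> p = 0\<close> by simp
    have sub: "e ` Poly_Mapping.keys p \<subseteq> B"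
      using e by (auto simp: bij_betw_def)
    show "p = 0"
    proof (rule poly_mapping_eqI)
      fix k
      show "Poly_Mapping.lookup p k = Poly_Mapping.lookup 0 k"
      proof (cases "k \<in> Poly_Mapping.keys p")
        case True
        then show ?thesis
          using pm.independentD[OF B(2) _ sub sum0, of "e k"] inj by simp
      qed (simp add: in_keys_iff)
    qed
  qed
  ultimately show ?thesis
    using lin by blast
qed

text \<open>The carrier of a \<open>lie_algebra\<close> is a whole type. A subspace closed under the
  bracket is turned into one by transporting the bracket along an injective linear
  \<open>\<phi>\<close> with that range.\<close>

locale lie_pullback = lie_algebra scale bracket + \<phi>: Vector_Spaces.linear scale' scale \<phi>
  for scale :: "'k::field \<Rightarrow> 'v::ab_group_add \<Rightarrow> 'v" (infixr \<open>*s\<close> 75) and bracket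
    and scale' :: "'k \<Rightarrow> 'w::ab_group_add \<Rightarrow> 'w" and \<phi> +
  assumes inj: "inj \<phi>"
    and closed: "x \<in> range \<phi> \<Longrightarrow> y \<in> range \<phi> \<Longrightarrow> bracket x y \<in> range \<phi>"
begin

definition pullback :: "'w \<Rightarrow> 'w \<Rightarrow> 'w" where
  "pullback x y = inv_into UNIV \<phi> (bracket (\<phi> x) (\<phi> y))"

lemma map_pullback: "\<phi> (pullback x y) = bracket (\<phi> x) (\<phi> y)"
  unfolding pullback_def by (rule f_inv_into_f) (simp add: closed)

sublocale pull: lie_algebra scale' pullback
proof
  have eqI: "\<phi> x = \<phi> y \<Longrightarrow> x = y" for x y
    by (rule injD[OF inj])
  fix x y z c
  show "pullback (x + y) z = pullback x z + pullback y z"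
    by (rule eqI) (simp add: map_pullback \<phi>.add bracket_add_left)
  show "pullback x (y + z) = pullback x y + pullback x z"
    by (rule eqI) (simp add: map_pullback \<phi>.add bracket_add_right)
  show "pullback (scale' c x) y = scale' c (pullback x y)"
    by (rule eqI) (simp add: map_pullback \<phi>.scale bracket_scale_left)
  show "pullback x (scale' c y) = scale' c (pullback x y)"
    by (rule eqI) (simp add: map_pullback \<phi>.scale bracket_scale_right)
  show "pullback x x = 0"
    by (rule eqI) (simp add: map_pullback \<phi>.zero bracket_self)
  show "pullback x (pullback y z) + pullback y (pullback z x) + pullback z (pullback x y) = 0"
    by (rule eqI) (simp add: map_pullback \<phi>.zero \<phi>.add jacobi)
qed

lemma lie_subalgebra_vimage:
  assumes "lie_subalgebra S"
  shows "pull.lie_subalgebra (\<phi> -` S)"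
  using assms \<phi>.subspace_vimage[of S] by (simp add: lie_subalgebra_def pull.lie_subalgebra_def map_pullback)

lemma lie_subalgebra_image:
  assumes "pull.lie_subalgebra S"
  shows "lie_subalgebra (\<phi> ` S)"
  using assms \<phi>.subspace_image[of S]
  by (auto simp: lie_subalgebra_def pull.lie_subalgebra_def map_pullback[symmetric])

text \<open>A basis of the preimage maps to an independent subset of \<open>S\<close>, which is
  finite because \<open>S\<close> lies in the span of a finite set.\<close>

lemma finite_dim_vimage:
  assumes "finite_dim S"
  shows "pull.finite_dim (\<phi> -` S)"
proof -
  obtain G where G: "finite G" "S \<subseteq> span G"
    using assms by (auto simp: finite_dim_def)
  obtain B where B: "B \<subseteq> \<phi> -` S" "\<phi>.vs1.independent B" "\<phi> -` S \<subseteq> \<phi>.vs1.span B"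
    using \<phi>.vs1.basis_exists[of "\<phi> -` S"] by metis
  have "independent (\<phi> ` B)"
    using \<phi>.independent_injective_image[OF B(2)] inj by (auto intro: inj_on_subset)
  moreover have "\<phi> ` B \<subseteq> span G"
    using B(1) G(2) by blast
  ultimately have "finite (\<phi> ` B)"
    using independent_span_bound[OF G(1)] by blast
  then have "finite B"
    using inj by (auto intro: finite_imageD inj_on_subset)
  then show ?thesis
    using B(3) by (auto simp: pull.finite_dim_def)
qed

lemma lie_generates_pullback:
  assumes X: "\<phi> ` X = G" and gen: "range \<phi> = \<Inter>{S. lie_subalgebra S \<and> G \<subseteq> S}"
  shows "pull.lie_generates X"
  unfolding pull.lie_generates_def
proof -
  have "x \<in> S" if S: "pull.lie_subalgebra S" "X \<subseteq> S" for x S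
  proof -
    have "G \<subseteq> \<phi> ` S"
      using X S(2) by blast
    then have "range \<phi> \<subseteq> \<phi> ` S"
      unfolding gen using lie_subalgebra_image[OF S(1)] by blast
    then show ?thesis
      using inj by (auto dest: injD)
  qed
  then show "\<Inter> {S. pull.lie_subalgebra S \<and> X \<subseteq> S} = UNIV"
    by blast
qed

end

section \<open>The growth filtration\<close>

context lie_algebra
begin

lemma lie_subalgebra_Inter: "(\<And>S. S \<in> \<S> \<Longrightarrow> lie_subalgebra S) \<Longrightarrow> lie_subalgebra (\<Inter>\<S>)"
  by (auto simp: lie_subalgebra_def intro: subspace_Inter)

lemma subspace_growth_space:
  assumes "subspace F"
  shows "subspace (growth_space F n)"
  using assms by (induction F n rule: growth_space.induct) (simp_all add: subspace_single_0 subspace_sums)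

lemma finite_dim_growth_space:
  assumes "finite_dim F"
  shows "finite_dim (growth_space F n)"
  using assms
proof (induction F n rule: growth_space.induct)
  case (1 F)
  show ?case
    by (auto simp: finite_dim_def intro!: exI[of _ "{}"])
next
  case (3 F n)
  obtain G H where G: "finite G" "growth_space F (Suc n) \<subseteq> span G" and H: "finite H" "F \<subseteq> span H"
    using 3 by (auto simp: finite_dim_def)
  let ?K = "G \<union> (\<lambda>(b, f). bracket b f) ` (G \<times> H)"
  have br: "bracket b f \<in> span ?K" if b: "b \<in> span G" and f: "f \<in> span H" for b f
  proof -
    have 1: "bracket g f \<in> span ?K" if "g \<in> G" for g
      using f
    proof (induction rule: span_induct_alt)
      case base
      show ?case
        using bracket_scale_right[of g 0 0] by (simp add: span_zero)
    next
      case (step c x y)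
      have "bracket g x \<in> span ?K"
        using that step(1) by (intro span_base) force
      then show ?case
        using step(2) by (simp add: bracket_add_right bracket_scale_right span_add span_scale)
    qed
    show ?thesis
      using b
    proof (induction rule: span_induct_alt)
      case base
      show ?case
        using bracket_scale_left[of 0 0 f] by (simp add: span_zero)
    next
      case (step c x y)
      then show ?case
        using 1 by (simp add: bracket_add_left bracket_scale_left span_add span_scale)
    qed
  qed
  have "span {bracket b f | b f. b \<in> growth_space F (Suc n) \<and> f \<in> F} \<subseteq> span ?K"
    by (rule span_minimal) (use br G H in auto)
  moreover have "growth_space F (Suc n) \<subseteq> span ?K"
    using G(2) span_mono[of G ?K] by auto
  ultimately have "growth_space F (Suc (Suc n)) \<subseteq> span ?K"
    by (auto intro!: span_add)
  then show ?case
    using G(1) H(1) unfolding finite_dim_def by (intro exI[of _ ?K]) auto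
qed simp

lemma growth_space_Suc_mono:
  assumes "subspace F"
  shows "growth_space F n \<subseteq> growth_space F (Suc n)"
proof (cases n)
  case 0
  then show ?thesis
    using subspace_0[OF assms] by simp
next
  case (Suc m)
  then show ?thesis
    using span_zero by force
qed

lemma bracket_in_growth_space:
  assumes "subspace F" "x \<in> growth_space F n" "f \<in> F"
  shows "bracket x f \<in> growth_space F (Suc n)"
proof (cases n)
  case 0
  then show ?thesis
    using assms bracket_scale_left[of 0 0 f] subspace_0[OF assms(1)] by simp
next
  case (Suc m)
  have "bracket x f \<in> span {bracket b f | b f. b \<in> growth_space F (Suc m) \<and> f \<in> F}"
    using assms Suc by (intro span_base) auto
  moreover have "0 \<in> growth_space F (Suc m)"
    by (rule subspace_0[OF subspace_growth_space[OF assms(1)]])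
  ultimately show ?thesis
    unfolding Suc growth_space.simps by (intro CollectI exI[of _ 0] exI[of _ "bracket x f"]) simp
qed

end

section \<open>Words with long zero runs\<close>

text \<open>The letters \<open>0, 1, 2, 3\<close> play the roles of \<open>t, x, y, z\<close>. The separators \<open>t\<^sup>m\<close> between blocks
  grow slowly enough for the number of block words to remain exponential in their length, but every
  factor without \<open>t\<^sup>n\<close> lies essentially in one \<open>n\<close>-th block.\<close>

fun block_words :: "nat \<Rightarrow> nat list set" where
  "block_words 0 = {[1], [2]}"
| "block_words (Suc m) = {u @ replicate m 0 @ v | u v. u \<in> block_words m \<and> v \<in> block_words m}"

abbreviation nonzeros :: "nat list \<Rightarrow> nat" where
  "nonzeros w \<equiv> length (filter (\<lambda>x. x \<noteq> 0) w)"

text \<open>The length is \<open>2 ^ Suc m - m - 1\<close>; the additive form avoids subtraction in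
  the induction.\<close>

lemma length_block_words: "w \<in> block_words m \<Longrightarrow> length w + m + 1 = 2 ^ Suc m"
proof (induction m arbitrary: w)
  case (Suc m)
  then obtain u v where "w = u @ replicate m 0 @ v" "u \<in> block_words m" "v \<in> block_words m"
    by auto
  then show ?case
    using Suc.IH[of u] Suc.IH[of v] by simp
qed auto

lemma nonzeros_block_words: "w \<in> block_words m \<Longrightarrow> nonzeros w = 2 ^ m"
proof (induction m arbitrary: w)
  case (Suc m)
  then obtain u v where "w = u @ replicate m 0 @ v" "u \<in> block_words m" "v \<in> block_words m"
    by auto
  then show ?case
    using Suc.IH[of u] Suc.IH[of v] by simp
qed auto

text \<open>Blocks of one level have equal length, so the two halves can be read off from a block of
  the next level. The number of blocks is therefore squared at each level.\<close>

lemma card_block_words: "finite (block_words m) \<and> card (block_words m) = 2 ^ 2 ^ m"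
proof (induction m)
  case 0
  show ?case
    by simp
next
  case (Suc m)
  let ?f = "\<lambda>(u, v). u @ replicate m (0::nat) @ v"
  have eq: "block_words (Suc m) = ?f ` (block_words m \<times> block_words m)"
    by auto
  have len: "length u = length v" if "u \<in> block_words m" "v \<in> block_words m" for u v
    using length_block_words[OF that(1)] length_block_words[OF that(2)] by linarith
  have inj: "inj_on ?f (block_words m \<times> block_words m)"
  proof (rule inj_onI, clarify)
    fix u v u' v' assume "u \<in> block_words m" "u' \<in> block_words m"
      and "u @ replicate m 0 @ v = u' @ replicate m 0 @ v'"
    then show "u = u' \<and> v = v'"
      using len[of u u'] by (metis append_eq_append_conv same_append_eq)
  qed
  have "finite (block_words (Suc m))"
    unfolding eq using Suc by blast
  moreover have "card (block_words (Suc m)) = 2 ^ 2 ^ Suc m"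
    unfolding eq card_image[OF inj] card_cartesian_product
    by (simp only: Suc power_add[symmetric] mult_2[symmetric] power_Suc)
  ultimately show ?case
    by blast
qed

lemma set_block_words: "w \<in> block_words m \<Longrightarrow> set w \<subseteq> {0, 1, 2}"
proof (induction m arbitrary: w)
  case (Suc m)
  then obtain u v where "w = u @ replicate m 0 @ v" "u \<in> block_words m" "v \<in> block_words m"
    by auto
  then show ?case
    using Suc.IH[of u] Suc.IH[of v] by auto
qed auto

lemma block_words_nonempty: "\<exists>w. w \<in> block_words m"
  using card_block_words[of m] by (metis card.empty ex_in_conv power_not_zero zero_neq_numeral)

lemma nonzeros_sublist_le: "sublist v w \<Longrightarrow> nonzeros v \<le> nonzeros w"
  by (auto simp: sublist_def)

text \<open>At a level above \<open>n\<close> the separator is a zero run of length at least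
  \<open>n\<close>. So \<open>w\<close> cannot contain all of it and takes nonzero letters from one
  half only. The descent ends at a level of at most \<open>n\<close>, where a block has at most
  \<open>2 ^ n\<close> nonzero letters.\<close>

lemma nonzeros_no_zero_run:
  assumes "u \<in> block_words M" "sublist w u" "\<not> sublist (replicate n 0) w"
  shows "nonzeros w \<le> 2 ^ n"
  using assms
proof (induction M arbitrary: u w)
  case 0
  then have "nonzeros w \<le> 1"
    using nonzeros_sublist_le[OF 0(2)] by auto
  also have "1 \<le> (2::nat) ^ n"
    by simp
  finally show ?case .
next
  case (Suc M)
  show ?case
  proof (cases "Suc M \<le> n")
    case True
    have "nonzeros w \<le> 2 ^ Suc M"
      using nonzeros_sublist_le[OF Suc.prems(2)] nonzeros_block_words[OF Suc.prems(1)] by simp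
    also have "\<dots> \<le> 2 ^ n"
      using True by (intro power_increasing) auto
    finally show ?thesis .
  next
    case False
    let ?Z = "replicate M 0 :: nat list"
    obtain a b where ab: "u = a @ ?Z @ b" "a \<in> block_words M" "b \<in> block_words M"
      using Suc.prems(1) by auto
    have run: "sublist (replicate n 0) ?Z"
    proof -
      have "?Z = replicate n 0 @ replicate (M - n) 0"
        using False unfolding replicate_add[symmetric] by simp
      then show ?thesis
        by simp
    qed
    have zeros: "nonzeros v = 0" if "sublist v ?Z" for v
      using nonzeros_sublist_le[OF that] by simp
    have IH: "nonzeros x \<le> 2 ^ n" if "v \<in> block_words M" "sublist x v" "sublist x w" for x v
      by (rule Suc.IH[OF that(1,2)]) (use Suc.prems(3) that(3) sublist_order.order_trans in blast)
    have mid: "nonzeros w \<le> 2 ^ n" if "sublist w (?Z @ b)"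
      using that unfolding sublist_append
    proof (elim disjE exE conjE)
      assume "sublist w ?Z"
      then show ?thesis
        using zeros by simp
    next
      assume "sublist w b"
      then show ?thesis
        by (rule IH[OF ab(3)]) simp
    next
      fix w1 w2 assume w: "w = w1 @ w2" "suffix w1 ?Z" "prefix w2 b"
      then have "nonzeros w1 = 0"
        using zeros suffix_imp_sublist by blast
      moreover have "nonzeros w2 \<le> 2 ^ n"
        by (rule IH[OF ab(3) prefix_imp_sublist[OF w(3)]]) (simp add: w(1))
      ultimately show ?thesis
        using w(1) by simp
    qed
    show ?thesis
      using Suc.prems(2) unfolding ab(1) sublist_append[of w a]
    proof (elim disjE exE conjE)
      assume "sublist w a"
      then show ?thesis
        by (rule IH[OF ab(2)]) simp
    next
      assume "sublist w (?Z @ b)"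
      then show ?thesis
        by (rule mid)
    next
      fix w1 w2 assume w: "w = w1 @ w2" "suffix w1 a" "prefix w2 (?Z @ b)"
      then consider "prefix w2 ?Z" | w3 where "w2 = ?Z @ w3"
        unfolding prefix_append by blast
      then show ?thesis
      proof cases
        case 1
        then have "nonzeros w2 = 0"
          using zeros prefix_imp_sublist by blast
        moreover have "nonzeros w1 \<le> 2 ^ n"
          by (rule IH[OF ab(2) suffix_imp_sublist[OF w(2)]]) (simp add: w(1))
        ultimately show ?thesis
          using w(1) by simp
      next
        case 2
        \<comment> \<open>Here \<open>w\<close> would reach across the whole separator.\<close>
        then have "sublist ?Z w"
          using w(1) by simp
        from sublist_order.order_trans[OF run this] show ?thesis
          using Suc.prems(3) by contradiction
      qed
    qed
  qed
qed

section \<open>The language of allowed words\<close>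

definition factor_words :: "nat list set" where
  "factor_words = {w. \<exists>m. \<exists>u\<in>block_words m. sublist w u}"

definition allowed_words :: "nat list set" where
  "allowed_words = factor_words \<union> (#) 3 ` factor_words"

lemma factor_words_sublist: "w \<in> factor_words \<Longrightarrow> sublist v w \<Longrightarrow> v \<in> factor_words"
  unfolding factor_words_def by (blast intro: sublist_order.order_trans)

lemma set_factor_words: "w \<in> factor_words \<Longrightarrow> set w \<subseteq> {0, 1, 2}"
  unfolding factor_words_def using set_block_words set_mono_sublist by blast

lemma block_in_factor_words: "w \<in> block_words m \<Longrightarrow> w \<in> factor_words"
  unfolding factor_words_def by blast

lemma Nil_in_factor_words: "[] \<in> factor_words"
  using factor_words_sublist[OF block_in_factor_words[of "[1]" 0]] by simp

lemma replicate_in_factor_words: "replicate m 0 \<in> factor_words"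
proof -
  obtain u where "u \<in> block_words m"
    using block_words_nonempty by blast
  then have "u @ replicate m 0 @ u \<in> block_words (Suc m)"
    by auto
  then show ?thesis
    using factor_words_sublist[OF block_in_factor_words] sublist_appendI by blast
qed

lemma letter_in_factor_words: "x \<in> {0, 1, 2} \<Longrightarrow> [x] \<in> factor_words"
  using block_in_factor_words[of _ 0] replicate_in_factor_words[of 1] by auto

text \<open>Equivalently, the words that are not allowed span an ideal of the free algebra; this
  makes the truncated product associative.\<close>

lemma allowed_wordsD:
  assumes "v @ w \<in> allowed_words"
  shows "v \<in> allowed_words" "w \<in> allowed_words"
proof -
  have "v \<in> allowed_words \<and> w \<in> allowed_words"
  proof (cases "v @ w \<in> factor_words")
    case True
    then show ?thesis
      using factor_words_sublist unfolding allowed_words_def by blast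
  next
    case False
    then obtain x where x: "v @ w = 3 # x" "x \<in> factor_words"
      using assms by (auto simp: allowed_words_def)
    show ?thesis
    proof (cases v)
      case Nil
      then show ?thesis
        using assms Nil_in_factor_words by (simp add: allowed_words_def)
    next
      case (Cons c v')
      then have "v = 3 # v'" "x = v' @ w"
        using x by auto
      then show ?thesis
        using x(2) factor_words_sublist[of x v'] factor_words_sublist[of x w]
        by (auto simp: allowed_words_def)
    qed
  qed
  then show "v \<in> allowed_words" "w \<in> allowed_words"
    by blast+
qed

lemma Cons_3_allowed_iff: "3 # w \<in> allowed_words \<longleftrightarrow> w \<in> factor_words"
  using set_factor_words[of "3 # w"] by (auto simp: allowed_words_def)

lemma Cons_Cons_3_not_allowed: "a # 3 # w \<notin> allowed_words"
  using set_factor_words[of "a # 3 # w"] set_factor_words[of "3 # w"] by (auto simp: allowed_words_def)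

lemma set_allowed_words: "w \<in> allowed_words \<Longrightarrow> set w \<subseteq> {0..3}"
  using set_factor_words unfolding allowed_words_def by fastforce

text \<open>The extra 1 accounts for a leading letter 3.\<close>

lemma nonzeros_allowed_words:
  assumes "w \<in> allowed_words" "\<not> sublist (replicate n 0) w"
  shows "nonzeros w \<le> 2 ^ n + 1"
proof -
  have *: "nonzeros v \<le> 2 ^ n" if "v \<in> factor_words" "\<not> sublist (replicate n 0) v" for v
    using that nonzeros_no_zero_run unfolding factor_words_def by blast
  show ?thesis
  proof (cases "w \<in> factor_words")
    case True
    then show ?thesis
      using *[OF True assms(2)] by simp
  next
    case False
    then obtain v where "w = 3 # v" "v \<in> factor_words"
      using assms(1) by (auto simp: allowed_words_def)
    then show ?thesis
      using *[of v] assms(2) sublist_Cons_right by (metis Suc_eq_plus1 Suc_le_mono filter.simps(2) le_SucI length_Cons)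
  qed
qed

text \<open>A zero run contains none of the factors completely, as each has a nonzero letter. It
  therefore meets at most two neighbouring factors, each in at most \<open>n\<close>
  letters.\<close>

lemma zero_run_concat:
  assumes "\<And>u. u \<in> set us \<Longrightarrow> length u \<le> n \<and> nonzeros u \<noteq> 0"
    and "sublist (replicate r 0) (concat us)"
  shows "r \<le> 2 * n"
  using assms
proof (induction us arbitrary: r)
  case (Cons u us)
  have nz: "\<not> sublist u (replicate s 0)" for s
    using nonzeros_sublist_le[of u "replicate s 0"] Cons.prems(1)[of u] by auto
  have pre: "s \<le> n" if "prefix (replicate s 0) (concat us)" for s
  proof (cases us)
    case (Cons v vs)
    then have "prefix (replicate s 0) v \<or> prefix v (replicate s 0)"
      using that by (metis concat.simps(2) prefix_prefix prefix_same_cases prefixI)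
    moreover have "\<not> prefix v (replicate s 0)"
      using nonzeros_sublist_le[of v "replicate s 0"] Cons.prems(1)[of v] \<open>us = v # vs\<close>
        prefix_imp_sublist by force
    ultimately show ?thesis
      using prefix_length_le Cons.prems(1)[of v] \<open>us = v # vs\<close> by fastforce
  qed (use that in simp)
  from Cons.prems(2) have "sublist (replicate r 0) (u @ concat us)"
    by simp
  then show ?case
    unfolding sublist_append
  proof (elim disjE exE conjE)
    assume "sublist (replicate r 0) u"
    then show ?thesis
      using sublist_length_le Cons.prems(1)[of u] by fastforce
  next
    assume "sublist (replicate r 0) (concat us)"
    then show ?thesis
      using Cons by simp
  next
    fix x y assume xy: "replicate r 0 = x @ y" "suffix x u" "prefix y (concat us)"
    then have "y = replicate (length y) 0" "length x + length y = r"
      by (metis append_eq_conv_conj drop_replicate length_append length_drop length_replicate add_diff_cancel_left')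
        (metis xy(1) length_append length_replicate)
    then show ?thesis
      using pre[of "length y"] xy(2,3) suffix_length_le Cons.prems(1)[of u] by fastforce
  qed
qed simp

text \<open>Closed under those concatenations that are allowed words, yet finite: a concatenation of factors
  of length at most \<open>n\<close> with a nonzero letter each has no zero run longer than \<open>2 n\<close>.\<close>

definition composite_words :: "nat \<Rightarrow> nat list set" where
  "composite_words n = {w \<in> allowed_words. \<exists>us. us \<noteq> [] \<and> w = concat us \<and>
     (\<forall>u\<in>set us. length u \<le> n \<and> nonzeros u \<noteq> 0)}"

lemma composite_words_append:
  assumes "v \<in> composite_words n" "w \<in> composite_words n" "v @ w \<in> allowed_words"
  shows "v @ w \<in> composite_words n"
proof -
  obtain us vs where "us \<noteq> []" "v = concat us" "\<forall>u\<in>set us. length u \<le> n \<and> nonzeros u \<noteq> 0"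
    "vs \<noteq> []" "w = concat vs" "\<forall>u\<in>set vs. length u \<le> n \<and> nonzeros u \<noteq> 0"
    using assms(1,2) by (auto simp: composite_words_def)
  then show ?thesis
    using assms(3) unfolding composite_words_def by (intro CollectI conjI exI[of _ "us @ vs"]) auto
qed

lemma nonzeros_composite_words: "w \<in> composite_words n \<Longrightarrow> nonzeros w \<noteq> 0"
  unfolding composite_words_def by (auto simp: filter_empty_conv) (metis list.set_intros(1) neq_Nil_conv)

text \<open>Zero runs have length at most \<open>2 * n\<close>, so there are at most
  \<open>?K\<close> nonzero letters. Each factor contains one of them, which leaves at most
  \<open>?K\<close> factors of length at most \<open>n\<close>.\<close>

lemma finite_composite_words: "finite (composite_words n)"
proof -
  let ?K = "2 ^ Suc (2 * n) + 1"
  have "length w \<le> n * ?K" if "w \<in> composite_words n" for w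
  proof -
    obtain us where us: "w = concat us" "\<And>u. u \<in> set us \<Longrightarrow> length u \<le> n \<and> nonzeros u \<noteq> 0"
      "w \<in> allowed_words"
      using \<open>w \<in> composite_words n\<close> by (auto simp: composite_words_def)
    have "\<not> sublist (replicate (Suc (2 * n)) 0) w"
      using zero_run_concat[OF us(2), where r = "Suc (2 * n)"] us(1) by auto
    then have "nonzeros w \<le> ?K"
      by (rule nonzeros_allowed_words[OF us(3)])
    moreover have "length us \<le> nonzeros w \<and> length w \<le> n * length us"
      unfolding us(1) using us(2)
    proof (induction us)
      case (Cons u us)
      then have "length us \<le> nonzeros (concat us) \<and> length (concat us) \<le> n * length us"
        by simp
      moreover have "length u \<le> n" "nonzeros u \<noteq> 0"
        using Cons.prems[of u] by auto
      moreover have eqs: "nonzeros (concat (u # us)) = nonzeros u + nonzeros (concat us)"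
        "length (concat (u # us)) = length u + length (concat us)"
        "length (u # us) = Suc (length us)" "n * Suc (length us) = n + n * length us"
        by simp_all
      ultimately show ?case
        unfolding eqs by linarith
    qed simp
    ultimately show ?thesis
      by (meson mult_le_mono2 order_trans)
  qed
  then have "composite_words n \<subseteq> {w. set w \<subseteq> {0..3} \<and> length w \<le> n * ?K}"
    using set_allowed_words by (auto simp: composite_words_def)
  then show ?thesis
    by (rule finite_subset) (intro finite_lists_length_le finite_atLeastAtMost)
qed

section \<open>The monomial Lie algebra\<close>

interpretation field_vs: vector_space "(*) :: 'k::field \<Rightarrow> 'k \<Rightarrow> 'k"
  by standard (auto simp: algebra_simps)

definition allowed_part :: "(nat list \<Rightarrow>\<^sub>0 'k::field) \<Rightarrow> (nat list \<Rightarrow>\<^sub>0 'k)" where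
  "allowed_part p = (\<Sum>w\<in>Poly_Mapping.keys p. pm_scale (Poly_Mapping.lookup p w)
     (if w \<in> allowed_words then pm_unit w else 0))"

lemma linear_allowed_part: "Vector_Spaces.linear pm_scale pm_scale allowed_part"
  unfolding allowed_part_def by (rule pm.linear_sum_keys)

lemmas allowed_part_add = linear_allowed_part[unfolded pm_linear_iff, THEN conjunct1, rule_format]
lemmas allowed_part_scale = linear_allowed_part[unfolded pm_linear_iff, THEN conjunct2, rule_format]

lemma allowed_part_zero: "allowed_part 0 = 0"
  by (simp add: allowed_part_def)

lemma allowed_part_diff: "allowed_part (p - q) = allowed_part p - allowed_part q"
  using allowed_part_add[of "p - q" q] by (simp add: algebra_simps)

lemma allowed_part_pm_unit: "allowed_part (pm_unit w) = (if w \<in> allowed_words then pm_unit w else 0)"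
  by (simp add: allowed_part_def)

lemma lookup_allowed_part:
  "Poly_Mapping.lookup (allowed_part p) w = (if w \<in> allowed_words then Poly_Mapping.lookup p w else 0)"
proof -
  have "Poly_Mapping.lookup (allowed_part p) w =
      (\<Sum>v\<in>Poly_Mapping.keys p. if v = w then (if w \<in> allowed_words then Poly_Mapping.lookup p w else 0) else 0)"
    unfolding allowed_part_def lookup_sum by (intro sum.cong) (auto simp: lookup_single when_def)
  then show ?thesis
    by (simp add: sum.delta in_keys_iff)
qed

lemma keys_allowed_part: "Poly_Mapping.keys (allowed_part p) = Poly_Mapping.keys p \<inter> allowed_words"
  by (auto simp: in_keys_iff lookup_allowed_part split: if_splits)

text \<open>Extending a word that is not allowed never gives an allowed one, so it may be dropped
  before or after multiplication.\<close>

lemma allowed_part_mult_left: "allowed_part (allowed_part p * q) = allowed_part (p * q)"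
proof -
  have "allowed_part (allowed_part (pm_unit u) * pm_unit v) = allowed_part (pm_unit u * pm_unit v)" for u v
    using allowed_wordsD(1)[of u v] by (auto simp: allowed_part_pm_unit allowed_part_zero mult_single plus_list_def)
  then have "allowed_part (allowed_part (pm_unit u) * q) = allowed_part (pm_unit u * q)" for u
    by (rule pm.linear_eq_on_pm_unit[where g = "\<lambda>q. allowed_part (allowed_part (pm_unit u) * q)", rotated 2])
      (simp_all add: pm_linear_iff distrib_left pm_scale_mult_right allowed_part_add allowed_part_scale)
  then show ?thesis
    by (rule pm.linear_eq_on_pm_unit[where g = "\<lambda>p. allowed_part (allowed_part p * q)", rotated 2])
      (simp_all add: pm_linear_iff distrib_right pm_scale_mult_left allowed_part_add allowed_part_scale)
qed

lemma allowed_part_mult_right: "allowed_part (p * allowed_part q) = allowed_part (p * q)"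
proof -
  have "allowed_part (pm_unit u * allowed_part (pm_unit v)) = allowed_part (pm_unit u * pm_unit v)" for u v
    using allowed_wordsD(2)[of u v] by (auto simp: allowed_part_pm_unit allowed_part_zero mult_single plus_list_def)
  then have "allowed_part (pm_unit u * allowed_part q) = allowed_part (pm_unit u * q)" for u
    by (rule pm.linear_eq_on_pm_unit[where g = "\<lambda>q. allowed_part (pm_unit u * allowed_part q)", rotated 2])
      (simp_all add: pm_linear_iff distrib_left pm_scale_mult_right allowed_part_add allowed_part_scale)
  then show ?thesis
    by (rule pm.linear_eq_on_pm_unit[where g = "\<lambda>p. allowed_part (p * allowed_part q)", rotated 2])
      (simp_all add: pm_linear_iff distrib_right pm_scale_mult_left allowed_part_add allowed_part_scale)
qed

text \<open>The commutator of the monomial algebra, whose product is \<open>allowed_part (p * q)\<close>.\<close>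

definition mono_bracket ::
  "(nat list \<Rightarrow>\<^sub>0 'k::field) \<Rightarrow> (nat list \<Rightarrow>\<^sub>0 'k) \<Rightarrow> (nat list \<Rightarrow>\<^sub>0 'k)" where
  "mono_bracket p q = allowed_part (p * q - q * p)"

interpretation mono: lie_algebra "pm_scale :: 'k::field \<Rightarrow> _ \<Rightarrow> _" mono_bracket
proof
  fix x y z :: "nat list \<Rightarrow>\<^sub>0 'k" and c :: 'k
  show "mono_bracket (x + y) z = mono_bracket x z + mono_bracket y z"
    "mono_bracket x (y + z) = mono_bracket x y + mono_bracket x z"
    unfolding mono_bracket_def allowed_part_add[symmetric] by (simp_all add: algebra_simps)
  show "mono_bracket (pm_scale c x) y = pm_scale c (mono_bracket x y)"
    "mono_bracket x (pm_scale c y) = pm_scale c (mono_bracket x y)"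
    unfolding mono_bracket_def allowed_part_scale[symmetric]
    by (simp_all add: pm_scale_mult_left pm_scale_mult_right pm.scale_right_diff_distrib)
  show "mono_bracket x x = 0"
    by (simp add: mono_bracket_def allowed_part_def)
  have br: "mono_bracket x (mono_bracket y z) = allowed_part (x * (y * z - z * y) - (y * z - z * y) * x)" for x y z :: "nat list \<Rightarrow>\<^sub>0 'k"
    by (simp only: mono_bracket_def allowed_part_diff[of "x * allowed_part (y * z - z * y)"]
        allowed_part_diff[of "x * (y * z - z * y)"] allowed_part_mult_left allowed_part_mult_right)
  have "(x * (y * z - z * y) - (y * z - z * y) * x) + (y * (z * x - x * z) - (z * x - x * z) * y) +
      (z * (x * y - y * x) - (x * y - y * x) * z) = 0"
    by (simp only: left_diff_distrib right_diff_distrib mult.assoc) simp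
  then show "mono_bracket x (mono_bracket y z) + mono_bracket y (mono_bracket z x) + mono_bracket z (mono_bracket x y) = 0"
    by (simp only: br allowed_part_add[symmetric] allowed_part_zero)
qed

section \<open>The Lie subalgebra generated by the letters\<close>

abbreviation letters :: "(nat list \<Rightarrow>\<^sub>0 'k::field) set" where
  "letters \<equiv> (\<lambda>x. pm_unit [x]) ` {0, 1, 2, 3}"

definition mono_lie :: "(nat list \<Rightarrow>\<^sub>0 'k::field) set" where
  "mono_lie = \<Inter>{S. mono.lie_subalgebra S \<and> letters \<subseteq> S}"

lemma lie_subalgebra_mono_lie: "mono.lie_subalgebra mono_lie"
  unfolding mono_lie_def by (rule mono.lie_subalgebra_Inter) blast

lemma subspace_mono_lie: "pm.subspace mono_lie"
  using lie_subalgebra_mono_lie unfolding mono.lie_subalgebra_def by blast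

lemma mono_bracket_closed: "x \<in> mono_lie \<Longrightarrow> y \<in> mono_lie \<Longrightarrow> mono_bracket x y \<in> mono_lie"
  using lie_subalgebra_mono_lie unfolding mono.lie_subalgebra_def by blast

lemma letters_subset_mono_lie: "letters \<subseteq> mono_lie"
  unfolding mono_lie_def by blast

lemma letter_in_mono_lie: "x \<in> {0, 1, 2, 3} \<Longrightarrow> pm_unit [x] \<in> mono_lie"
  by (rule subsetD[OF letters_subset_mono_lie imageI])

text \<open>A concatenation is a power of \<open>a\<close> exactly if both parts consist of copies
  of \<open>a\<close> and the total length is right, a condition symmetric in the two parts.
  Commutators thus have coefficient 0 at powers of a letter.\<close>

lemma lookup_replicate_mult_commute:
  "Poly_Mapping.lookup (p * q) (replicate j a) = Poly_Mapping.lookup (q * p) (replicate j a)"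
  for p q :: "'c list \<Rightarrow>\<^sub>0 'k::field"
proof -
  have comm: "u @ v = replicate j a \<longleftrightarrow> v @ u = replicate j a" for u v :: "'c list"
  proof -
    have eq: "w = replicate j a \<longleftrightarrow> length w = j \<and> set w \<subseteq> {a}" for w
      by (auto intro: replicate_eqI)
    show ?thesis
      unfolding eq by auto
  qed
  have lin: "Vector_Spaces.linear pm_scale (*) (\<lambda>p. Poly_Mapping.lookup (p * q) w)"
    "Vector_Spaces.linear pm_scale (*) (\<lambda>q. Poly_Mapping.lookup (p * q) w)" for p q :: "'c list \<Rightarrow>\<^sub>0 'k" and w
    by (simp_all add: Vector_Spaces.linear_iff pm.vector_space_axioms field_vs.vector_space_axioms
        distrib_left distrib_right lookup_add pm_scale_mult_left pm_scale_mult_right)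
  have "Poly_Mapping.lookup (pm_unit u * pm_unit v :: _ \<Rightarrow>\<^sub>0 'k) (replicate j a) =
      Poly_Mapping.lookup (pm_unit v * pm_unit u) (replicate j a)" for u v
    using comm by (simp add: mult_single plus_list_def lookup_single)
  then have "Poly_Mapping.lookup (pm_unit u * q) (replicate j a) =
      Poly_Mapping.lookup (q * pm_unit u) (replicate j a)" for u
    by (rule field_vs.linear_eq_on_pm_unit[OF lin(2,1)])
  then show ?thesis
    by (rule field_vs.linear_eq_on_pm_unit[OF lin(1,2)])
qed

lemma lookup_replicate_mono_bracket: "Poly_Mapping.lookup (mono_bracket p q) (replicate j 0) = 0"
  using lookup_replicate_mult_commute[of p q j 0]
  by (simp add: mono_bracket_def lookup_allowed_part lookup_minus)

lemma keys_mono_bracket: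
  "Poly_Mapping.keys (mono_bracket p q) \<subseteq> allowed_words \<inter>
    {u @ v | u v. u \<in> Poly_Mapping.keys p \<and> v \<in> Poly_Mapping.keys q \<or>
      u \<in> Poly_Mapping.keys q \<and> v \<in> Poly_Mapping.keys p}"
proof
  fix w assume w: "w \<in> Poly_Mapping.keys (mono_bracket p q)"
  then have "w \<in> allowed_words"
    by (simp add: mono_bracket_def keys_allowed_part)
  moreover have "Poly_Mapping.lookup (p * q) w \<noteq> 0 \<or> Poly_Mapping.lookup (q * p) w \<noteq> 0"
    using w by (auto simp: mono_bracket_def keys_allowed_part in_keys_iff lookup_minus)
  then have "w \<in> Poly_Mapping.keys (p * q) \<or> w \<in> Poly_Mapping.keys (q * p)"
    by (simp add: in_keys_iff)
  then have "\<exists>u v. w = u @ v \<and> (u \<in> Poly_Mapping.keys p \<and> v \<in> Poly_Mapping.keys q \<or>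
      u \<in> Poly_Mapping.keys q \<and> v \<in> Poly_Mapping.keys p)"
    using subsetD[OF keys_mult[of p q], of w] subsetD[OF keys_mult[of q p], of w]
    unfolding plus_list_def by blast
  ultimately show "w \<in> allowed_words \<inter>
      {u @ v | u v. u \<in> Poly_Mapping.keys p \<and> v \<in> Poly_Mapping.keys q \<or>
        u \<in> Poly_Mapping.keys q \<and> v \<in> Poly_Mapping.keys p}"
    by blast
qed

lemma subspace_keys_subset: "pm.subspace {p :: 'a \<Rightarrow>\<^sub>0 'k::field. Poly_Mapping.keys p \<subseteq> A}"
proof (rule pm.subspaceI)
  show "p + q \<in> {p. Poly_Mapping.keys p \<subseteq> A}"
    if "p \<in> {p. Poly_Mapping.keys p \<subseteq> A}" "q \<in> {p. Poly_Mapping.keys p \<subseteq> A}" for p q :: "'a \<Rightarrow>\<^sub>0 'k"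
    using that Poly_Mapping.keys_add[of p q] by blast
qed (auto simp: in_keys_iff subset_iff)

text \<open>The elements with both properties form a subalgebra containing the letters, since
  brackets have coefficient 0 at every power of the letter 0. Hence \<open>t\<close> itself is the
  only power of \<open>t\<close> that occurs.\<close>

lemma mono_lie_support:
  assumes "p \<in> mono_lie"
  shows "Poly_Mapping.keys p \<subseteq> allowed_words" "j \<noteq> 1 \<Longrightarrow> Poly_Mapping.lookup p (replicate j 0) = 0"
proof -
  let ?S = "{p :: nat list \<Rightarrow>\<^sub>0 'a. Poly_Mapping.keys p \<subseteq> allowed_words \<and>
    (\<forall>j. j \<noteq> 1 \<longrightarrow> Poly_Mapping.lookup p (replicate j 0) = 0)}"
  have "pm.subspace {p :: nat list \<Rightarrow>\<^sub>0 'a. \<forall>j. j \<noteq> 1 \<longrightarrow> Poly_Mapping.lookup p (replicate j 0) = 0}"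
    by (rule pm.subspaceI) (simp_all add: lookup_add)
  then have "pm.subspace ?S"
    unfolding Collect_conj_eq by (intro pm.subspace_inter subspace_keys_subset)
  moreover have "mono_bracket p q \<in> ?S" for p q
    using lookup_replicate_mono_bracket[of p q] keys_mono_bracket[of p q] by simp
  ultimately have "mono.lie_subalgebra ?S"
    unfolding mono.lie_subalgebra_def by blast
  moreover have "letters \<subseteq> ?S"
  proof -
    have "[x] \<in> allowed_words" if "x \<in> {0, 1, 2, 3}" for x
      using that letter_in_factor_words Nil_in_factor_words by (auto simp: allowed_words_def)
    moreover have "Poly_Mapping.lookup (pm_unit [x]) (replicate j 0) = 0" if "j \<noteq> 1" for x j
    proof (rule lookup_single_not_eq)
      show "[x] \<noteq> replicate j 0"
        using that by (metis One_nat_def length_replicate length_Cons list.size(3))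
    qed
    ultimately show ?thesis
      by auto
  qed
  ultimately have "mono_lie \<subseteq> ?S"
    unfolding mono_lie_def by blast
  with assms have "p \<in> ?S"
    by (rule subsetD[rotated])
  then show "Poly_Mapping.keys p \<subseteq> allowed_words" "j \<noteq> 1 \<Longrightarrow> Poly_Mapping.lookup p (replicate j 0) = 0"
    by simp_all
qed

text \<open>In the reversed product the letter 3 stands second, so that product vanishes.\<close>

lemma mono_bracket_Cons_3:
  assumes "a \<noteq> 3"
  shows "mono_bracket (pm_unit (3 # w)) (pm_unit [a]) = allowed_part (pm_unit (3 # w @ [a]))"
  using Cons_Cons_3_not_allowed[of a w]
  by (simp add: mono_bracket_def mult_single plus_list_def allowed_part_diff allowed_part_pm_unit)

lemma Cons_3_in_mono_lie:
  "w \<in> factor_words \<Longrightarrow> (pm_unit (3 # w) :: nat list \<Rightarrow>\<^sub>0 'k::field) \<in> mono_lie"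
proof (induction w rule: rev_induct)
  case Nil
  show ?case
    by (rule letter_in_mono_lie) simp
next
  case (snoc a w)
  have a: "a \<in> {0, 1, 2}"
    using set_factor_words[OF snoc.prems] by simp
  have "(pm_unit (3 # w) :: nat list \<Rightarrow>\<^sub>0 'k) \<in> mono_lie"
    using snoc factor_words_sublist[of "w @ [a]" w] by simp
  then have "mono_bracket (pm_unit (3 # w)) (pm_unit [a]) \<in> (mono_lie :: (nat list \<Rightarrow>\<^sub>0 'k) set)"
    using a by (intro mono_bracket_closed letter_in_mono_lie) auto
  then show ?case
    using a snoc.prems by (auto simp: mono_bracket_Cons_3 allowed_part_pm_unit Cons_3_allowed_iff)
qed

section \<open>The locally finite-dimensional kernel\<close>

definition mono_kernel :: "(nat list \<Rightarrow>\<^sub>0 'k::field) set" where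
  "mono_kernel = {p \<in> mono_lie. Poly_Mapping.lookup p [0] = 0}"

lemma subspace_mono_kernel: "pm.subspace mono_kernel"
  unfolding mono_kernel_def
  by (rule pm.subspaceI)
    (use pm.subspace_0[OF subspace_mono_lie] pm.subspace_add[OF subspace_mono_lie]
      pm.subspace_scale[OF subspace_mono_lie] in \<open>auto simp: lookup_add\<close>)

lemma lookup_mono_bracket: "Poly_Mapping.lookup (mono_bracket p q) [0] = 0"
  using lookup_replicate_mono_bracket[of p q 1] by simp

text \<open>All words in the support of a kernel element contain a letter other than 0. If
  \<open>n\<close> bounds their lengths for all elements of \<open>X\<close>, they lie in the finite
  set \<open>composite_words n\<close>, and the elements of the Lie algebra supported there form a
  subalgebra.\<close>

lemma mono_kernel_locally_finite:
  fixes X :: "(nat list \<Rightarrow>\<^sub>0 'k::field) set"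
  assumes "finite X" "X \<subseteq> mono_kernel"
  shows "\<exists>S. mono.lie_subalgebra S \<and> mono.finite_dim S \<and> X \<subseteq> S \<and> S \<subseteq> mono_kernel"
proof -
  define n where "n = Max (insert 0 (length ` (\<Union>p\<in>X. Poly_Mapping.keys p)))"
  define S :: "(nat list \<Rightarrow>\<^sub>0 'k) set" where "S = {p \<in> mono_lie. Poly_Mapping.keys p \<subseteq> composite_words n}"
  have "mono.lie_subalgebra S"
  proof -
    have "S = mono_lie \<inter> {p. Poly_Mapping.keys p \<subseteq> composite_words n}"
      by (auto simp: S_def)
    then have "pm.subspace S"
      using pm.subspace_inter[OF subspace_mono_lie subspace_keys_subset] by simp
    moreover have "mono_bracket p q \<in> S" if "p \<in> S" "q \<in> S" for p q
    proof -
      have "w \<in> composite_words n" if "w \<in> Poly_Mapping.keys (mono_bracket p q)" for w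
      proof -
        obtain u v where "w = u @ v" "w \<in> allowed_words" "u \<in> composite_words n" "v \<in> composite_words n"
          using subsetD[OF keys_mono_bracket \<open>w \<in> Poly_Mapping.keys (mono_bracket p q)\<close>] \<open>p \<in> S\<close> \<open>q \<in> S\<close> unfolding S_def by blast
        then show ?thesis
          using composite_words_append by blast
      qed
      then show ?thesis
        using that mono_bracket_closed unfolding S_def by blast
    qed
    ultimately show ?thesis
      unfolding mono.lie_subalgebra_def by blast
  qed
  moreover have "mono.finite_dim S"
    unfolding mono.finite_dim_def
  proof (intro exI[of _ "pm_unit ` composite_words n"] conjI)
    show "finite (pm_unit ` composite_words n)"
      using finite_composite_words by blast
    show "S \<subseteq> pm.span (pm_unit ` composite_words n)"
      using in_span_pm_unit unfolding S_def by blast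
  qed
  moreover have "X \<subseteq> S"
  proof
    fix p assume p: "p \<in> X"
    then have pK: "p \<in> mono_lie" "Poly_Mapping.lookup p [0] = 0"
      using assms(2) by (auto simp: mono_kernel_def)
    have "w \<in> composite_words n" if w: "w \<in> Poly_Mapping.keys p" for w
    proof -
      have "length w \<le> n"
        unfolding n_def by (rule Max_ge) (use assms(1) p w in auto)
      moreover have "nonzeros w \<noteq> 0"
      proof
        assume "nonzeros w = 0"
        then have "w = replicate (length w) 0"
          by (intro replicate_eqI) (auto simp: filter_empty_conv)
        then have "Poly_Mapping.lookup p w = 0"
          using mono_lie_support(2)[OF pK(1), of "length w"] pK(2) by (cases "length w = 1") auto
        then show False
          using w by (simp add: in_keys_iff)
      qed
      moreover have "w \<in> allowed_words"
        using mono_lie_support(1)[OF pK(1)] w by blast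
      ultimately show ?thesis
        unfolding composite_words_def by (intro CollectI conjI exI[of _ "[w]"]) auto
    qed
    then show "p \<in> S"
      using pK(1) by (auto simp: S_def)
  qed
  moreover have "S \<subseteq> mono_kernel"
    using nonzeros_composite_words[of "[0]" n] by (auto simp: S_def mono_kernel_def in_keys_iff)
  ultimately show ?thesis
    by blast
qed

text \<open>The words consisting of the letter 3 and a zero run lie in the kernel and are
  independent. This feeds \<open>linear_parametrization\<close>.\<close>

lemma mono_kernel_infinite_dim:
  assumes "finite G"
  shows "\<not> mono_kernel \<subseteq> pm.span (G :: (nat list \<Rightarrow>\<^sub>0 'k::field) set)"
proof
  let ?W = "range (\<lambda>m. 3 # replicate m (0::nat))"
  assume "mono_kernel \<subseteq> pm.span G"
  moreover have "pm_unit ` ?W \<subseteq> (mono_kernel :: (nat list \<Rightarrow>\<^sub>0 'k) set)"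
    using Cons_3_in_mono_lie replicate_in_factor_words by (auto simp: mono_kernel_def lookup_single)
  ultimately have "finite (pm_unit ` ?W :: (nat list \<Rightarrow>\<^sub>0 'k) set)"
    using pm.independent_span_bound[OF assms independent_pm_unit] by blast
  then have "finite ?W"
    by (rule finite_imageD) (simp add: inj_on_def pm_unit_eq_iff)
  moreover have "inj (\<lambda>m. 3 # replicate m (0::nat))"
    by (rule injI) (metis length_replicate list.inject)
  ultimately show False
    using finite_imageD infinite_UNIV_nat by blast
qed

lemma mono_lie_infinite_dim:
  assumes "finite G"
  shows "\<not> mono_lie \<subseteq> pm.span (G :: (nat list \<Rightarrow>\<^sub>0 'k::field) set)"
  using mono_kernel_infinite_dim[OF assms] by (auto simp: mono_kernel_def)

text \<open>Instantiated twice, with the Lie algebra and with its kernel as the range of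
  \<open>\<phi>\<close>; both rely on \<open>locally_finite_vimage\<close>.\<close>

locale mono_pullback =
  lie_pullback "pm_scale :: 'k::field \<Rightarrow> (nat list \<Rightarrow>\<^sub>0 'k) \<Rightarrow> _" mono_bracket
    "pm_scale :: 'k \<Rightarrow> (nat \<Rightarrow>\<^sub>0 'k) \<Rightarrow> _" \<phi> for \<phi>
begin

lemma locally_finite_vimage:
  assumes "finite X" "\<phi> ` X \<subseteq> mono_kernel"
  shows "\<exists>S. pull.lie_subalgebra S \<and> pull.finite_dim S \<and> X \<subseteq> S"
proof -
  obtain S where "mono.lie_subalgebra S" "mono.finite_dim S" "\<phi> ` X \<subseteq> S"
    using mono_kernel_locally_finite[OF finite_imageI[OF assms(1)] assms(2)] by blast
  then show ?thesis
    using lie_subalgebra_vimage finite_dim_vimage by (intro exI[of _ "\<phi> -` S"]) auto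
qed

context
  assumes range: "range \<phi> = mono_lie"
begin

lemma obtain_preimage:
  assumes "p \<in> mono_lie"
  obtains x where "\<phi> x = p"
  using assms range by (metis imageE)

lemma amenable_pullback: "pull.amenable"
proof -
  obtain t where t: "\<phi> t = pm_unit [0]"
    by (rule obtain_preimage[OF letter_in_mono_lie[of 0]]) auto
  show ?thesis
  proof (rule pull.amenable_if_codim_1_locally_finite_dimensional
      [where \<pi> = "\<lambda>x. Poly_Mapping.lookup (\<phi> x) [0]" and t = t])
    fix X :: "(nat \<Rightarrow>\<^sub>0 'k) set"
    assume "finite X" "(\<lambda>x. Poly_Mapping.lookup (\<phi> x) [0]) ` X \<subseteq> {0}"
    then show "\<exists>S. pull.lie_subalgebra S \<and> pull.finite_dim S \<and> X \<subseteq> S"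
      using range by (intro locally_finite_vimage) (auto simp: mono_kernel_def)
  qed (simp_all add: \<phi>.add \<phi>.scale lookup_add t map_pullback lookup_mono_bracket)
qed

section \<open>Finite generation and exponential growth\<close>

lemma letters_generate:
  "finite (\<phi> -` letters)" "\<phi> ` (\<phi> -` letters) = letters" "pull.lie_generates (\<phi> -` letters)"
proof -
  show "finite (\<phi> -` letters)"
    by (rule finite_vimageI[OF _ inj]) blast
  show *: "\<phi> ` (\<phi> -` letters) = letters"
    unfolding image_vimage_eq range by (rule Int_absorb2[OF letters_subset_mono_lie])
  show "pull.lie_generates (\<phi> -` letters)"
    by (rule lie_generates_pullback[OF *]) (simp only: range mono_lie_def)
qed

lemma finitely_generated_pullback: "pull.finitely_generated"
  unfolding pull.finitely_generated_def using letters_generate(1,3) by blast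

text \<open>Each bracket with a letter appends it and raises the index by one. The letter 3 alone
  lies at index 1, where the filtration starts.\<close>

lemma Cons_3_in_growth_space:
  assumes "w \<in> factor_words"
  shows "pm_unit (3 # w) \<in> \<phi> ` pull.growth_space (pm.span (\<phi> -` letters)) (Suc (length w))"
  using assms
proof (induction w rule: rev_induct)
  case Nil
  obtain x where x: "\<phi> x = pm_unit [3]"
    by (rule obtain_preimage[OF letter_in_mono_lie[of 3]]) auto
  then have "x \<in> pm.span (\<phi> -` letters)"
    by (intro pm.span_base) simp
  then have "\<phi> x \<in> \<phi> ` pm.span (\<phi> -` letters)"
    by (rule imageI)
  then show ?case
    by (simp add: x)
next
  case (snoc a w)
  have a: "a \<in> {0, 1, 2}"
    using set_factor_words[OF snoc.prems] by simp
  have "w \<in> factor_words"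
    using factor_words_sublist[OF snoc.prems, of w] by simp
  from snoc.IH[OF this] obtain x where x: "pm_unit (3 # w) = \<phi> x"
    "x \<in> pull.growth_space (pm.span (\<phi> -` letters)) (Suc (length w))"
    by (rule imageE)
  obtain y where y: "\<phi> y = pm_unit [a]"
    by (rule obtain_preimage[OF letter_in_mono_lie[of a]]) (use a in auto)
  have "y \<in> \<phi> -` letters"
    unfolding vimage_eq y by (rule imageI) (use a in auto)
  then have "pullback x y \<in> pull.growth_space (pm.span (\<phi> -` letters)) (Suc (Suc (length w)))"
    by (intro pull.bracket_in_growth_space[OF pm.subspace_span x(2)] pm.span_base)
  then have "\<phi> (pullback x y) \<in> \<phi> ` pull.growth_space (pm.span (\<phi> -` letters)) (Suc (Suc (length w)))"
    by (rule imageI)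
  moreover have "\<phi> (pullback x y) = pm_unit (3 # w @ [a])"
  proof -
    have "3 # w @ [a] \<in> allowed_words" "a \<noteq> 3"
      using a snoc.prems by (auto simp: Cons_3_allowed_iff)
    then show ?thesis
      by (simp add: map_pullback x(1)[symmetric] y mono_bracket_Cons_3 allowed_part_pm_unit)
  qed
  ultimately show ?case
    by (simp only: length_append_singleton)
qed

text \<open>For a block \<open>w\<close> of level \<open>m\<close> the word \<open>3 # w\<close> has
  length at most \<open>2 ^ Suc m\<close>, so at this index all these independent words have been
  reached.\<close>

lemma dim_growth_space_ge:
  "2 ^ 2 ^ m \<le> pm.dim (pull.growth_space (pm.span (\<phi> -` letters)) (2 ^ Suc m))"
proof -
  let ?F = "pm.span (\<phi> -` letters)"
  let ?V = "pull.growth_space ?F (2 ^ Suc m)"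
  let ?I = "pm_unit ` (#) 3 ` block_words m :: (nat list \<Rightarrow>\<^sub>0 'k) set"
  obtain G where G: "G \<subseteq> ?V" "pm.independent G" "?V \<subseteq> pm.span G" "card G = pm.dim ?V"
    by (rule pm.basis_exists)
  have "pull.finite_dim ?F"
    using letters_generate(1) by (auto simp: pull.finite_dim_def)
  then obtain H where "finite H" "?V \<subseteq> pm.span H"
    using pull.finite_dim_growth_space[of ?F "2 ^ Suc m"] by (auto simp: pull.finite_dim_def)
  then have finG: "finite G"
    using pm.independent_span_bound[of H G] G(1,2) by (meson subset_trans)
  have "?I \<subseteq> \<phi> ` ?V"
  proof (rule subsetI, elim imageE, hypsubst)
    fix w assume w: "w \<in> block_words m"
    have "Suc (length w) \<le> 2 ^ Suc m"
      using length_block_words[OF w] by linarith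
    then have "pull.growth_space ?F (Suc (length w)) \<subseteq> ?V"
      by (rule lift_Suc_mono_le[of "pull.growth_space ?F", rotated])
        (rule pull.growth_space_Suc_mono, rule pm.subspace_span)
    then show "pm_unit (3 # w) \<in> \<phi> ` ?V"
      using Cons_3_in_growth_space[OF block_in_factor_words[OF w]] by blast
  qed
  also have "\<dots> \<subseteq> \<phi> ` pm.span G"
    using G(3) by blast
  also have "\<dots> = pm.span (\<phi> ` G)"
    by (rule \<phi>.span_image[symmetric])
  finally have "card ?I \<le> card (\<phi> ` G)"
    using pm.independent_span_bound[OF finite_imageI[OF finG] independent_pm_unit] by blast
  also have "\<dots> \<le> pm.dim ?V"
    using card_image_le[OF finG, of \<phi>] G(4) by simp
  finally have "card ?I \<le> pm.dim ?V" .
  moreover have "card ?I = card (block_words m)"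
    by (simp add: image_image card_image inj_on_def pm_unit_eq_iff)
  ultimately show ?thesis
    using card_block_words[of m] by simp
qed

text \<open>Along the indices \<open>2 ^ Suc m\<close> the root is at least \<open>sqrt 2\<close>,
  because \<open>sqrt 2\<close> raised to that power is \<open>2 ^ 2 ^ m\<close>.\<close>

lemma exponential_growth_pullback: "pull.exponential_growth"
  unfolding pull.exponential_growth_def
proof (intro exI[of _ "pm.span (\<phi> -` letters)"] conjI)
  let ?F = "pm.span (\<phi> -` letters)"
  let ?u = "\<lambda>n. ereal (root n (real (pm.dim (pull.growth_space ?F n))))"
  show "pm.subspace ?F"
    by (rule pm.subspace_span)
  show "pull.finite_dim ?F"
    using letters_generate(1) by (auto simp: pull.finite_dim_def)
  show "pull.lie_generates ?F"
    using letters_generate(3) pm.span_superset[of "\<phi> -` letters"] unfolding pull.lie_generates_def by blast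
  have u: "ereal (sqrt 2) \<le> ?u (2 ^ Suc m)" for m
  proof -
    have "sqrt 2 ^ (2 ^ Suc m) = 2 ^ (2 ^ m)"
      by (simp add: power_mult)
    also have "\<dots> = real (2 ^ 2 ^ m)"
      by simp
    also have "\<dots> \<le> real (pm.dim (pull.growth_space ?F (2 ^ Suc m)))"
      by (rule of_nat_mono[OF dim_growth_space_ge])
    finally have "root (2 ^ Suc m) (sqrt 2 ^ (2 ^ Suc m)) \<le>
        root (2 ^ Suc m) (real (pm.dim (pull.growth_space ?F (2 ^ Suc m))))"
      by (intro real_root_le_mono) auto
    also have "root (2 ^ Suc m) (sqrt 2 ^ (2 ^ Suc m)) = sqrt 2"
      by (rule real_root_power_cancel) auto
    finally show ?thesis
      by (rule ereal_less_eq(3)[THEN iffD2])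
  qed
  have "ereal (sqrt 2) \<le> limsup ?u"
    unfolding limsup_INF_SUP
  proof (rule INF_greatest)
    fix n :: nat
    have "n \<le> 2 ^ Suc n"
      using less_exp[of "Suc n"] by linarith
    then show "ereal (sqrt 2) \<le> (SUP m\<in>{n..}. ?u m)"
      using u[of n] by (intro SUP_upper2[where i = "2 ^ Suc n"]) auto
  qed
  moreover have "1 < ereal (sqrt 2)"
    by simp
  ultimately show "1 < limsup ?u"
    by (rule less_le_trans[rotated])
qed

end

end

text \<open>The algebra and its kernel both have a countably infinite basis, hence the common type
  \<open>nat \<Rightarrow>\<^sub>0 'k\<close>. The quotient is the field itself with zero
  bracket.\<close>

theorem theorem9:
  shows "\<exists>(scaleL :: 'k::field \<Rightarrow> (nat \<Rightarrow>\<^sub>0 'k) \<Rightarrow> (nat \<Rightarrow>\<^sub>0 'k)) bracketL.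
    lie_algebra scaleL bracketL \<and>
    lie_algebra.amenable scaleL bracketL \<and>
    lie_algebra.finitely_generated scaleL bracketL \<and>
    lie_algebra.exponential_growth scaleL bracketL \<and>
    (\<exists>(scaleK :: 'k \<Rightarrow> (nat \<Rightarrow>\<^sub>0 'k) \<Rightarrow> (nat \<Rightarrow>\<^sub>0 'k)) bracketK
      (scaleQ :: 'k \<Rightarrow> 'k \<Rightarrow> 'k) bracketQ \<iota> \<pi>.
      lie_algebra scaleK bracketK \<and>
      lie_algebra scaleQ bracketQ \<and>
      lie_hom scaleK bracketK scaleL bracketL \<iota> \<and>
      lie_hom scaleL bracketL scaleQ bracketQ \<pi> \<and>
      inj \<iota> \<and> range \<iota> = {x. \<pi> x = 0} \<and> surj \<pi> \<and>
      lie_algebra.locally_finite_dimensional scaleK bracketK \<and>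
      vector_space.dim scaleQ UNIV = 1)"
proof -
  obtain \<phi>L :: "(nat \<Rightarrow>\<^sub>0 'k) \<Rightarrow> (nat list \<Rightarrow>\<^sub>0 'k)" where
    L: "Vector_Spaces.linear pm_scale pm_scale \<phi>L" "inj \<phi>L" "range \<phi>L = mono_lie"
    using linear_parametrization[OF subspace_mono_lie mono_lie_infinite_dim] by blast
  obtain \<phi>K :: "(nat \<Rightarrow>\<^sub>0 'k) \<Rightarrow> (nat list \<Rightarrow>\<^sub>0 'k)" where
    K: "Vector_Spaces.linear pm_scale pm_scale \<phi>K" "inj \<phi>K" "range \<phi>K = mono_kernel"
    using linear_parametrization[OF subspace_mono_kernel mono_kernel_infinite_dim] by blast
  have kernel_subset: "mono_kernel \<subseteq> mono_lie"
    by (auto simp: mono_kernel_def)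
  interpret L: mono_pullback \<phi>L
    by (intro mono_pullback.intro lie_pullback.intro lie_pullback_axioms.intro mono.lie_algebra_axioms L(1,2))
      (simp add: L(3) mono_bracket_closed)
  interpret K: mono_pullback \<phi>K
    by (intro mono_pullback.intro lie_pullback.intro lie_pullback_axioms.intro mono.lie_algebra_axioms K(1,2))
      (use kernel_subset in \<open>auto simp: K(3) mono_kernel_def mono_bracket_closed lookup_mono_bracket\<close>)
  \<comment> \<open>\<open>\<iota>\<close> is the inclusion of the kernel and \<open>\<pi>\<close>
    the coefficient of \<open>t\<close>, both in the coordinates given by \<open>\<phi>K\<close> and
    \<open>\<phi>L\<close>.\<close>
  define \<iota> where "\<iota> = inv_into UNIV \<phi>L \<circ> \<phi>K"
  define \<pi> where "\<pi> x = Poly_Mapping.lookup (\<phi>L x) [0]" for x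
  have \<iota>: "\<phi>L (\<iota> x) = \<phi>K x" for x
  proof -
    have "\<phi>K x \<in> range \<phi>L"
      using K(3) kernel_subset unfolding L(3) by blast
    then show ?thesis
      by (simp add: \<iota>_def f_inv_into_f)
  qed
  have eqI: "\<phi>L x = \<phi>L y \<Longrightarrow> x = y" for x y
    by (rule injD[OF L(2)])
  have "Vector_Spaces.linear pm_scale pm_scale \<iota>"
    unfolding pm_linear_iff
    by (intro conjI allI eqI) (simp_all add: \<iota> L.\<phi>.add L.\<phi>.scale K.\<phi>.add K.\<phi>.scale)
  moreover have "\<iota> (K.pullback x y) = L.pullback (\<iota> x) (\<iota> y)" for x y
    by (rule eqI) (simp add: \<iota> L.map_pullback K.map_pullback)
  ultimately have hom_\<iota>: "lie_hom pm_scale K.pullback pm_scale L.pullback \<iota>"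
    by (simp add: lie_hom_def)
  have hom_\<pi>: "lie_hom pm_scale L.pullback (*) (\<lambda>_ _. 0) \<pi>"
    by (simp add: lie_hom_def \<pi>_def Vector_Spaces.linear_iff pm.vector_space_axioms field_vs.vector_space_axioms
        L.\<phi>.add L.\<phi>.scale lookup_add L.map_pullback lookup_mono_bracket)
  have inj_\<iota>: "inj \<iota>"
    using K(2) \<iota> by (metis injD injI)
  have "range \<iota> = {x. \<pi> x = 0}"
  proof (intro equalityI subsetI)
    fix x assume "x \<in> range \<iota>"
    then obtain y where "\<phi>L x = \<phi>K y"
      using \<iota> by auto
    moreover have "\<phi>K y \<in> mono_kernel"
      using K(3) by blast
    ultimately show "x \<in> {x. \<pi> x = 0}"
      by (simp add: \<pi>_def mono_kernel_def)
  next
    fix x assume "x \<in> {x. \<pi> x = 0}"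
    then have "\<phi>L x \<in> mono_kernel"
      using L(3) by (auto simp: \<pi>_def mono_kernel_def)
    then obtain y where "\<phi>L x = \<phi>K y"
      using K(3) by (metis imageE)
    then have "x = \<iota> y"
      by (intro eqI) (simp add: \<iota>)
    then show "x \<in> range \<iota>"
      by blast
  qed
  moreover have "surj \<pi>"
  proof -
    obtain t where "\<phi>L t = pm_unit [0]"
      by (rule L.obtain_preimage[OF L(3) letter_in_mono_lie[of 0]]) auto
    then have "\<pi> (pm_scale c t) = c" for c
      by (simp add: \<pi>_def L.\<phi>.scale)
    then show ?thesis
      by (rule surjI)
  qed
  moreover have "K.pull.locally_finite_dimensional"
    unfolding K.pull.locally_finite_dimensional_def
    using K.locally_finite_vimage K(3) by blast
  moreover have "lie_algebra ((*) :: 'k \<Rightarrow> 'k \<Rightarrow> 'k) (\<lambda>_ _. 0)"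
    by unfold_locales auto
  moreover have "field_vs.dim (UNIV :: 'k set) = 1"
  proof (rule field_vs.dim_unique[of "{1}"])
    show "UNIV \<subseteq> field_vs.span {1 :: 'k}"
      using field_vs.span_scale[OF field_vs.span_base[of 1 "{1}"]] by (metis insertI1 mult.right_neutral subsetI)
    show "field_vs.independent {1 :: 'k}"
      by simp
  qed auto
  ultimately show ?thesis
    using L.pull.lie_algebra_axioms L.amenable_pullback[OF L(3)] L.finitely_generated_pullback[OF L(3)]
      L.exponential_growth_pullback[OF L(3)] K.pull.lie_algebra_axioms hom_\<iota> hom_\<pi> inj_\<iota>
    by (intro exI conjI)
qed

end
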